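(* Let $u,p_1,p_2,f\in C_{rd}(H,\mathbb{R}_+)$. Suppose that $$u(x,y,z)\le p_1(x,y,z)+p_2(x,y,z)\int_{x_0}^{x}\int_{y_0}^{y}\int_a^b f(s,\tau,q)\,u(s,\tau,q)\,\Delta q\,\Delta\tau\,\Delta s$$ for all $(x,y,z)\in H$. Then $$u(x,y,z)\le p_1(x,y,z)+p_2(x,y,z)\,C(x,y)\,e_{Q(\cdot,y,z)}(x,x_0)$$ for all $(x,y,z)\in H$, where $$Q(x,y,z)=\int_{y_0}^{y}\int_a^b f(x,\tau,q)\,p_2(x,\tau,q)\,\Delta q\,\Delta\tau$$ (which does not actually depend on $z$) and $$C(x,y)=\int_{x_0}^{x}\int_{y_0}^{y}\int_a^b f(s,\tau,q)\,p_1(s,\tau,q)\,\Delta q\,\Delta\tau\,\Delta s .$$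
   Context: A time scale is a nonempty closed subset of $\mathbb{R}$. $\mathbb{T}_1,\mathbb{T}_2$ are two time scales, each with at least two points; $x_0\in\mathbb{T}_1$ and $y_0\in\mathbb{T}_2$ are fixed base points with $x\ge x_0$ for all $x\in\mathbb{T}_1$ and $y\ge y_0$ for all $y\in\mathbb{T}_2$. $I=[a,b]\subset\mathbb{R}$ is a real interval with $a<b$, $\Omega=\mathbb{T}_1\times\mathbb{T}_2$, $H=\Omega\times I$, and $\mathbb{R}_+=[0,\infty)$. Integrals are iterated delta integrals of time scale calculus; on $I$ the integral $\int_a^b\cdots\Delta q$ is the ordinary integral $\int_a^b\cdots dq$. For a time scale $\mathbb{T}$, $\sigma(t)=\inf\{s\in\mathbb{T}:s>t\}$ (with $\inf\emptyset=\sup\mathbb{T}$); $t$ is right-dense if $\sigma(t)=t$, right-scattered if $\sigma(t)>t$, and left-dense if $t$ is a limit of points $s\in\mathbb{T}$ with $s<t$. A function of one variable is rd-continuous if it is continuous at right-dense points and has finite left-sided limits at left-dense points. On a product $X_1\times\cdots\times X_n$ of time scales ($I$ and $\mathbb{R}$ being time scales), rd-continuity is understood jointly: for each point $P=(t_1,\dots,t_n)$ and each choice of sets $E_i$, where $E_i=X_i$ if $t_i$ is right-dense, and $E_i=\{t_i\}$ or (allowed only if $t_i$ is left-dense) $E_i=\{s\in X_i:s<t_i\}$ if $t_i$ is right-scattered, the limit at $P$ of the function restricted to $E_1\times\cdots\times E_n$ exists and is finite, and it equals the value at $P$ when no $E_i$ is of the last kind. $C_{rd}(X,Y)$ denotes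 the set of rd-continuous functions $X\to Y$. For an rd-continuous $p:\mathbb{T}_1\to[0,\infty)$, $e_p(\cdot,x_0)$ is the time scale exponential function, i.e. the unique solution on $\mathbb{T}_1$ of $w^{\Delta}(x)=p(x)w(x)$, $w(x_0)=1$. The expression $e_{Q(\cdot,y,z)}(x,x_0)$ is this exponential for $p(\cdot)=Q(\cdot,y,z)$ with $y,z$ held fixed. *)

theory Defs
  imports "HOL-Analysis.Analysis"
begin

definition time_scale :: "real set \<Rightarrow> bool" where
  "time_scale T \<longleftrightarrow> closed T \<and> T \<noteq> {}"

(* The first case is the convention inf {} = sup T; there T has a greatest element t. *)
definition sigma :: "real set \<Rightarrow> real \<Rightarrow> real" where
  "sigma T t = (if {s \<in> T. t < s} = {} then Sup T else Inf {s \<in> T. t < s})"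

definition right_dense :: "real set \<Rightarrow> real \<Rightarrow> bool" where
  "right_dense T t \<longleftrightarrow> sigma T t = t"

definition left_dense :: "real set \<Rightarrow> real \<Rightarrow> bool" where
  "left_dense T t \<longleftrightarrow> t islimpt {s \<in> T. s < t}"

text \<open>The set usually written T with superscript kappa: T without its maximum, if that
  maximum is left-scattered.\<close>

definition kappa :: "real set \<Rightarrow> real set" where
  "kappa T = T - {m. (\<forall>s\<in>T. s \<le> m) \<and> (\<exists>s\<in>T. s < m) \<and> \<not> left_dense T m}"

text \<open>The sets E over which a coordinate may vary in the definition of joint
  rd-continuity.\<close>

definition approach_sets :: "real set \<Rightarrow> real \<Rightarrow> real set set" where
  "approach_sets T t =
     (if right_dense T t then {T}
      else {{t}} \<union> (if left_dense T t then {{s \<in> T. s < t}} else {}))"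

(* The point P belongs to the product of the E_i exactly when none of them is a set of the
   form {s \<in> X. s < t}. The limits are punctured at P; requiring L = g P whenever P lies in
   the product makes this agree with the unpunctured limit. *)
definition rd_continuous3 ::
    "real set \<Rightarrow> real set \<Rightarrow> real set \<Rightarrow> (real \<times> real \<times> real \<Rightarrow> real) \<Rightarrow> bool" where
  "rd_continuous3 X1 X2 X3 g \<longleftrightarrow>
     (\<forall>t1\<in>X1. \<forall>t2\<in>X2. \<forall>t3\<in>X3.
      \<forall>E1\<in>approach_sets X1 t1. \<forall>E2\<in>approach_sets X2 t2. \<forall>E3\<in>approach_sets X3 t3.
        \<exists>L. (g \<longlongrightarrow> L) (at (t1, t2, t3) within E1 \<times> E2 \<times> E3) \<and>
            ((t1, t2, t3) \<in> E1 \<times> E2 \<times> E3 \<longrightarrow> L = g (t1, t2, t3)))"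

definition Crd3 ::
    "real set \<Rightarrow> real set \<Rightarrow> real set \<Rightarrow> real set \<Rightarrow> (real \<times> real \<times> real \<Rightarrow> real) set" where
  "Crd3 X1 X2 X3 Y = {g. rd_continuous3 X1 X2 X3 g \<and> g ` (X1 \<times> X2 \<times> X3) \<subseteq> Y}"

definition has_delta_derivative ::
    "real set \<Rightarrow> (real \<Rightarrow> real) \<Rightarrow> real \<Rightarrow> real \<Rightarrow> bool" where
  "has_delta_derivative T F D t \<longleftrightarrow>
     (\<forall>\<epsilon>>0. \<exists>\<delta>>0. \<forall>s\<in>T. \<bar>s - t\<bar> < \<delta> \<longrightarrow>
        \<bar>F (sigma T t) - F s - D * (sigma T t - s)\<bar> \<le> \<epsilon> * \<bar>sigma T t - s\<bar>)"

text \<open>The (Cauchy) delta integral: the increment of any delta antiderivative on T.\<close>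

definition delta_integral :: "real set \<Rightarrow> real \<Rightarrow> real \<Rightarrow> (real \<Rightarrow> real) \<Rightarrow> real" where
  "delta_integral T c d g =
     (THE v. \<exists>F. (\<forall>t\<in>kappa T. has_delta_derivative T F (g t) t) \<and> v = F d - F c)"

(* The solution is unique only as a function on T, so the description picks its value at t
   rather than the total function w. *)
definition delta_exp :: "real set \<Rightarrow> (real \<Rightarrow> real) \<Rightarrow> real \<Rightarrow> real \<Rightarrow> real" where
  "delta_exp T p t t0 =
     (THE v. \<exists>w. (\<forall>s\<in>kappa T. has_delta_derivative T w (p s * w s) s) \<and> w t0 = 1 \<and> v = w t)"

end

theory Submission
  imports Defs
begin

text \<open>Composing an rd-continuous g with the map sending s to the largest point of the time scale
  not exceeding s gives a regulated function on the reals, whose ordinary integral is a delta antiderivative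
  of g. Hence delta integrals are ordinary integrals, and dominated convergence shows that iterated
  integrals of jointly rd-continuous functions are rd-continuous in the remaining variable.

  Let w(x, y) be the iterated integral of f u. Since w increases in y, the hypothesis gives, for
  fixed y, that the delta derivative of w in x is at most c + Q w, where c is the delta derivative
  of C. A comparison principle for linear delta differential inequalities, proved by induction
  along the time scale, then bounds w by C times the exponential of Q.\<close>

section \<open>Induction on time scales and linear delta differential inequalities\<close>

text \<open>\<open>delta_integral\<close> and \<open>delta_exp\<close> are definite descriptions, so
  nothing can be evaluated before existence and uniqueness are known. The comparison principle
  serves twice: applied to differences of solutions it gives uniqueness for both descriptions, and
  applied to a barrier it gives the Gronwall bound. It depends on the sign of the coefficient q:
  crossing a gap of length m multiplies by 1 + q m, which keeps an inequality in its direction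
  because q \<ge> 0. The other obstacle is that jointly rd-continuous functions need not be
  continuous, so their boundedness on compact boxes, which dominated convergence requires, has to be
  rebuilt from the finitely many limits at each point.\<close>

locale based_time_scale =
  fixes T :: "real set" and x0 :: real
  assumes closed_T: "closed T" and x0_in: "x0 \<in> T" and x0_le: "\<And>t. t \<in> T \<Longrightarrow> x0 \<le> t"
begin

text \<open>The first case contains the right-dense points and also a greatest element of T, by the
  convention for the empty infimum. In the second case the infimum is attained because T is
  closed.\<close>

lemma sigma_cases:
  assumes t: "t \<in> T"
  obtains "sigma T t = t" | "t < sigma T t" "sigma T t \<in> T" "\<And>s. s \<in> T \<Longrightarrow> t < s \<Longrightarrow> sigma T t \<le> s"
proof (cases "{s \<in> T. t < s} = {}")
  case True
  then have "Sup T = t"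
    using t by (intro cSup_eq_maximum) auto
  then show ?thesis
    using that(1) True unfolding sigma_def by simp
next
  case False
  let ?U = "{s \<in> T. t < s}"
  have sg: "sigma T t = Inf ?U"
    using False unfolding sigma_def by (simp only: if_False)
  have bdd: "bdd_below ?U" by (auto intro!: bdd_belowI[of _ t])
  have ge: "t \<le> sigma T t"
    unfolding sg using False by (intro cInf_greatest) auto
  have "Inf ?U \<in> closure ?U"
    using False bdd by (rule closure_contains_Inf)
  also have "\<dots> \<subseteq> T"
    using closed_T by (intro closure_minimal) auto
  finally have "sigma T t \<in> T" unfolding sg .
  moreover have "\<And>s. s \<in> T \<Longrightarrow> t < s \<Longrightarrow> sigma T t \<le> s"
    unfolding sg using bdd by (intro cInf_lower) auto
  ultimately show ?thesis
    using that ge by (cases "sigma T t = t") auto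
qed

lemma sigma_in: "t \<in> T \<Longrightarrow> sigma T t \<in> T"
  by (rule sigma_cases) auto

lemma sigma_ge: "t \<in> T \<Longrightarrow> t \<le> sigma T t"
  by (rule sigma_cases) auto

lemma sigma_eq_if_islimpt:
  assumes "t islimpt {s \<in> T. t < s}"
  shows "sigma T t = t" "t \<in> T"
proof -
  show t: "t \<in> T"
    using islimpt_subset[OF assms, of T] closed_T unfolding closed_limpt by auto
  show "sigma T t = t"
    using t
  proof (cases rule: sigma_cases)
    case 2
    then obtain s where "s \<in> T" "t < s" "dist s t < sigma T t - t"
      using assms unfolding islimpt_approachable by (auto dest: spec[of _ "sigma T t - t"])
    with 2(3)[of s] show ?thesis by (auto simp: dist_real_def)
  qed
qed

lemma in_kappaI: "t \<in> T \<Longrightarrow> s \<in> T \<Longrightarrow> t < s \<Longrightarrow> t \<in> kappa T"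
  unfolding kappa_def by force

lemma left_dense_in_kappa: "t \<in> T \<Longrightarrow> left_dense T t \<Longrightarrow> t \<in> kappa T"
  unfolding kappa_def by auto

lemma kappa_subset: "t \<in> kappa T \<Longrightarrow> t \<in> T"
  unfolding kappa_def by auto

text \<open>The infimum c of the counterexamples lies in T, since T is closed. If P c holds,
  \<open>dense\<close> or the gap after c keeps counterexamples away from c on the right. If P c
  fails, c is neither x0 nor left-dense, so it is reached by a jump from a point where P
  holds.\<close>

lemma time_scale_induct [consumes 1, case_names base jump dense limit]:
  assumes "t \<in> T"
    and base: "P x0"
    and jump: "\<And>t. t \<in> T \<Longrightarrow> t < sigma T t \<Longrightarrow> P t \<Longrightarrow> P (sigma T t)"
    and dense: "\<And>t. t \<in> T \<Longrightarrow> sigma T t = t \<Longrightarrow> P t \<Longrightarrow> \<exists>\<delta>>0. \<forall>s\<in>T. t < s \<and> s < t + \<delta> \<longrightarrow> P s"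
    and limit: "\<And>t. t \<in> T \<Longrightarrow> left_dense T t \<Longrightarrow> (\<And>s. s \<in> T \<Longrightarrow> s < t \<Longrightarrow> P s) \<Longrightarrow> P t"
  shows "P t"
proof (rule ccontr)
  assume "\<not> P t"
  define B where "B = {s \<in> T. \<not> P s}"
  define c where "c = Inf B"
  have B: "B \<noteq> {}" using \<open>\<not> P t\<close> \<open>t \<in> T\<close> by (auto simp: B_def)
  have bdd: "bdd_below B" using x0_le by (auto simp: B_def intro!: bdd_belowI[of _ x0])
  have "c \<in> closure B" unfolding c_def using B bdd by (rule closure_contains_Inf)
  also have "\<dots> \<subseteq> T" using closed_T by (intro closure_minimal) (auto simp: B_def)
  finally have cT: "c \<in> T" .
  have below: "P s" if "s \<in> T" "s < c" for s
    using that cInf_lower[OF _ bdd] unfolding c_def B_def by fastforce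
  have near: "\<exists>s\<in>B. c \<le> s \<and> s < c + d" if "d > 0" for d
    using that cInf_lessD[OF B, of "c + d"] cInf_lower[OF _ bdd] unfolding c_def by fastforce
  show False
  proof (cases "P c")
    case True
    show False using cT
    proof (cases rule: sigma_cases)
      case 1
      from dense[OF cT 1 True] obtain d where d: "d > 0" "\<forall>s\<in>T. c < s \<and> s < c + d \<longrightarrow> P s" by blast
      from near[OF d(1)] obtain s where "s \<in> B" "c \<le> s" "s < c + d" by blast
      with d True show False by (cases "s = c") (auto simp: B_def)
    next
      case 2
      obtain s where s: "s \<in> B" "c \<le> s" "s < c + (sigma T c - c)" using near[of "sigma T c - c"] 2 by auto
      with 2(3)[of s] True show False by (cases "s = c") (auto simp: B_def)
    qed
  next
    case False
    have "c \<noteq> x0" using False base by auto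
    then have x0c: "x0 < c" using x0_le[OF cT] by simp
    have nl: "\<not> left_dense T c" using limit[OF cT] below False by blast
    let ?L = "{s \<in> T. s < c}"
    \<comment> \<open>As c is not left-dense, \<open>r\<close> turns out to be the immediate
      predecessor of c in T, and \<open>jump\<close> leads from \<open>r\<close> to c.\<close>
    define r where "r = Sup ?L"
    have ne: "?L \<noteq> {}" using x0_in x0c by auto
    have bdda: "bdd_above ?L" by (auto intro!: bdd_aboveI[of _ c])
    have rcl: "r \<in> closure ?L" unfolding r_def using ne bdda by (rule closure_contains_Sup)
    have "closure ?L \<subseteq> T" using closed_T by (intro closure_minimal) auto
    then have rT: "r \<in> T" using rcl by auto
    have "r \<le> c" unfolding r_def using ne by (intro cSup_least) auto
    moreover have "r \<noteq> c" using rcl nl unfolding left_dense_def closure_def by auto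
    ultimately have rc: "r < c" by simp
    have upper: "s \<le> r" if "s \<in> T" "s < c" for s
      unfolding r_def using that bdda by (intro cSup_upper) auto
    have "sigma T r = c" using rT
    proof (cases rule: sigma_cases)
      case 1
      have U: "{s \<in> T. r < s} \<noteq> {}" using cT rc by auto
      have "c \<le> Inf {s \<in> T. r < s}" using U upper by (intro cInf_greatest) (auto simp: not_less[symmetric])
      moreover have "sigma T r = Inf {s \<in> T. r < s}"
        using U unfolding sigma_def by (simp only: if_False)
      ultimately show ?thesis using 1 rc by linarith
    next
      case 2
      with upper[of "sigma T r"] 2(3)[OF cT rc] show ?thesis by force
    qed
    with jump[OF rT] rc below[OF rT rc] False show False by auto
  qed
qed

end

text \<open>The point s = t passes the test \<bar>s - t\<bar> < \<delta> for every \<delta>, so the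
  error at s = t is below every positive multiple of the gap length and must vanish.\<close>

lemma delta_derivative_jump:
  assumes F: "has_delta_derivative T F D t" and t: "t \<in> T"
  shows "F (sigma T t) = F t + D * (sigma T t - t)"
proof -
  let ?m = "sigma T t - t"
  have *: "\<bar>F (sigma T t) - F t - D * ?m\<bar> \<le> e * \<bar>?m\<bar>" if "e > 0" for e
    using F t that unfolding has_delta_derivative_def by fastforce
  have "\<bar>F (sigma T t) - F t - D * ?m\<bar> \<le> 0 + e" if "e > 0" for e
  proof -
    have "e / (\<bar>?m\<bar> + 1) * \<bar>?m\<bar> \<le> e" using that by (simp add: field_simps)
    with *[of "e / (\<bar>?m\<bar> + 1)"] that show ?thesis by (simp add: add_pos_nonneg)
  qed
  then have "\<bar>F (sigma T t) - F t - D * ?m\<bar> \<le> 0" by (rule field_le_epsilon)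
  then show ?thesis by simp
qed

text \<open>By the jump formula, F t - F s is the error term of the delta derivative at s plus D *
  (t - s), and both are small for s near t.\<close>

lemma delta_derivative_continuous:
  assumes F: "has_delta_derivative T F D t" and t: "t \<in> T"
  shows "(F \<longlongrightarrow> F t) (at t within T)"
proof -
  let ?s = "sigma T t"
  \<comment> \<open>\<open>m\<close> bounds \<bar>?s - s\<bar> as soon as \<bar>s - t\<bar> < 1, and
    \<open>n\<close> is a positive bound for \<bar>D\<bar>; each is used to make its term at most e
    / 2.\<close>
  define m n where "m = \<bar>?s - t\<bar> + 1" and "n = \<bar>D\<bar> + 1"
  have mn: "m > 0" "n > 0" by (auto simp: m_def n_def add_nonneg_pos)
  have "\<exists>d>0. \<forall>s\<in>T. s \<noteq> t \<and> dist s t < d \<longrightarrow> dist (F s) (F t) < e" if e: "e > 0" for e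
  proof -
    define k where "k = e / (2 * m)"
    have k: "k > 0" "k * m = e / 2" using e mn by (auto simp: k_def)
    obtain d where d: "d > 0" and
      dd: "\<And>s. s \<in> T \<Longrightarrow> \<bar>s - t\<bar> < d \<Longrightarrow> \<bar>F ?s - F s - D * (?s - s)\<bar> \<le> k * \<bar>?s - s\<bar>"
      using F k unfolding has_delta_derivative_def by blast
    define d' where "d' = min d (min 1 (e / (2 * n)))"
    have d': "d' > 0" "d' \<le> d" "d' \<le> 1" "n * d' \<le> e / 2"
      using d e mn mult_left_mono[of d' "e / (2 * n)" n] by (auto simp: d'_def)
    have "dist (F s) (F t) < e" if s: "s \<in> T" "dist s t < d'" for s
    proof -
      have st: "\<bar>s - t\<bar> < d'" using s by (simp add: dist_real_def)
      have eq: "F t - F s = (F ?s - F s - D * (?s - s)) + D * (t - s)"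
        using delta_derivative_jump[OF F t] by (simp add: algebra_simps)
      have "\<bar>F t - F s\<bar> \<le> \<bar>F ?s - F s - D * (?s - s)\<bar> + \<bar>D\<bar> * \<bar>t - s\<bar>"
        unfolding eq abs_mult[symmetric] by (rule abs_triangle_ineq)
      moreover have "\<bar>F ?s - F s - D * (?s - s)\<bar> \<le> k * \<bar>?s - s\<bar>"
        using dd[of s] s st d' by simp
      moreover have "k * \<bar>?s - s\<bar> \<le> k * m"
        using st d' k by (intro mult_left_mono) (auto simp: m_def)
      moreover have "\<bar>D\<bar> * \<bar>t - s\<bar> < n * d'"
        using st mn by (intro mult_strict_mono) (auto simp: n_def)
      ultimately show ?thesis using k d' unfolding dist_real_def by linarith
    qed
    with d' show ?thesis by blast
  qed
  then show ?thesis unfolding Lim_within zero_less_dist_iff by blast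
qed

text \<open>Shift, scaling and sum are combined so that the auxiliary functions built later are
  differentiated by instantiation alone.\<close>

lemma delta_derivative_lincomb:
  assumes F: "has_delta_derivative T F D t" and G: "has_delta_derivative T G E t"
  shows "has_delta_derivative T (\<lambda>s. c + \<alpha> * F s + \<beta> * G s) (\<alpha> * D + \<beta> * E) t"
  unfolding has_delta_derivative_def
proof (intro allI impI)
  fix e :: real assume e: "e > 0"
  let ?s = "sigma T t"
  define k where "k = e / (\<bar>\<alpha>\<bar> + \<bar>\<beta>\<bar> + 1)"
  have k: "k > 0" using e by (simp add: k_def add_nonneg_pos)
  have "(\<bar>\<alpha>\<bar> + \<bar>\<beta>\<bar> + 1) * k = e" by (simp add: k_def add_nonneg_pos)
  then have ke: "(\<bar>\<alpha>\<bar> + \<bar>\<beta>\<bar>) * k \<le> e" using k by (simp add: algebra_simps)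
  obtain d1 where d1: "d1 > 0"
      "\<And>s. s \<in> T \<Longrightarrow> \<bar>s - t\<bar> < d1 \<Longrightarrow> \<bar>F ?s - F s - D * (?s - s)\<bar> \<le> k * \<bar>?s - s\<bar>"
    using F k unfolding has_delta_derivative_def by blast
  obtain d2 where d2: "d2 > 0"
      "\<And>s. s \<in> T \<Longrightarrow> \<bar>s - t\<bar> < d2 \<Longrightarrow> \<bar>G ?s - G s - E * (?s - s)\<bar> \<le> k * \<bar>?s - s\<bar>"
    using G k unfolding has_delta_derivative_def by blast
  show "\<exists>d>0. \<forall>s\<in>T. \<bar>s - t\<bar> < d \<longrightarrow>
      \<bar>c + \<alpha> * F ?s + \<beta> * G ?s - (c + \<alpha> * F s + \<beta> * G s) - (\<alpha> * D + \<beta> * E) * (?s - s)\<bar> \<le> e * \<bar>?s - s\<bar>"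
  proof (intro exI[of _ "min d1 d2"] conjI ballI impI)
    fix s assume s: "s \<in> T" "\<bar>s - t\<bar> < min d1 d2"
    have "\<bar>c + \<alpha> * F ?s + \<beta> * G ?s - (c + \<alpha> * F s + \<beta> * G s) - (\<alpha> * D + \<beta> * E) * (?s - s)\<bar>
        = \<bar>\<alpha> * (F ?s - F s - D * (?s - s)) + \<beta> * (G ?s - G s - E * (?s - s))\<bar>"
      by (simp add: algebra_simps)
    also have "\<dots> \<le> \<bar>\<alpha>\<bar> * \<bar>F ?s - F s - D * (?s - s)\<bar> + \<bar>\<beta>\<bar> * \<bar>G ?s - G s - E * (?s - s)\<bar>"
      by (metis abs_mult abs_triangle_ineq)
    also have "\<dots> \<le> \<bar>\<alpha>\<bar> * (k * \<bar>?s - s\<bar>) + \<bar>\<beta>\<bar> * (k * \<bar>?s - s\<bar>)"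
      using s d1 d2 by (intro add_mono mult_left_mono) auto
    also have "\<dots> = (\<bar>\<alpha>\<bar> + \<bar>\<beta>\<bar>) * k * \<bar>?s - s\<bar>" by (simp add: algebra_simps)
    also have "\<dots> \<le> e * \<bar>?s - s\<bar>"
      using ke by (intro mult_right_mono) auto
    finally show "\<bar>c + \<alpha> * F ?s + \<beta> * G ?s - (c + \<alpha> * F s + \<beta> * G s) - (\<alpha> * D + \<beta> * E) * (?s - s)\<bar> \<le> e * \<bar>?s - s\<bar>" .
  qed (use d1 d2 in auto)
qed

section \<open>Comparison and uniqueness for linear delta equations\<close>

context based_time_scale
begin

text \<open>D is kept above the barrier - e * E for every e > 0, and then e tends to 0. The barrier
  falls strictly faster than any function with D' \<ge> q * D that touches it, which is what lets
  the induction leave a right-dense point.\<close>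

lemma delta_comparison:
  fixes D D' q :: "real \<Rightarrow> real"
  assumes deriv: "\<And>t. t \<in> kappa T \<Longrightarrow> has_delta_derivative T D (D' t) t"
    and ineq: "\<And>t. t \<in> T \<Longrightarrow> t < X \<Longrightarrow> q t * D t \<le> D' t"
    and q: "\<And>t. t \<in> T \<Longrightarrow> t < X \<Longrightarrow> 0 \<le> q t \<and> q t \<le> K"
    and init: "0 \<le> D x0" and X: "X \<in> T"
  shows "0 \<le> D X"
proof -
  \<comment> \<open>M exceeds every q t by at least 1; at right-dense points this surplus pays for
    the error of the delta derivative.\<close>
  define M where "M = \<bar>K\<bar> + 1"
  define E where "E = (\<lambda>t. exp (M * (t - x0)))"
  have E: "E t > 0" for t by (simp add: E_def)
  have bound: "- e * E X \<le> D X" if e: "e > 0" for e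
  proof -
    have "t \<le> X \<longrightarrow> - e * E t \<le> D t" if "t \<in> T" for t
      using that
    proof (induction rule: time_scale_induct)
      case base
      show ?case using init e E[of x0] by (smt (verit) mult_minus_left mult_pos_pos)
    next
      case (jump t)
      let ?s = "sigma T t"
      show ?case
      proof
        assume sX: "?s \<le> X"
        then have tX: "t < X" using jump by simp
        have qt: "0 \<le> q t" "q t \<le> M" using q[OF jump(1) tX] by (auto simp: M_def)
        have "E ?s = E t * exp (M * (?s - t))" unfolding E_def exp_add[symmetric] by (simp add: algebra_simps)
        moreover have "1 + q t * (?s - t) \<le> exp (M * (?s - t))"
          using exp_ge_add_one_self[of "M * (?s - t)"] mult_right_mono[OF qt(2), of "?s - t"] jump by linarith
        ultimately have "E t * (1 + q t * (?s - t)) \<le> E ?s" using E[of t] by simp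
        then have "- e * E ?s \<le> (- e * E t) * (1 + q t * (?s - t))" using e by (simp add: mult.assoc)
        \<comment> \<open>Here q t \<ge> 0 is essential: it makes the factor nonnegative, so the
          induction hypothesis at t may be multiplied by it.\<close>
        also have "\<dots> \<le> D t * (1 + q t * (?s - t))"
          using jump tX qt by (intro mult_right_mono) auto
        also have "\<dots> = D t + q t * D t * (?s - t)" by (simp add: algebra_simps)
        also have "\<dots> \<le> D t + D' t * (?s - t)"
          using ineq[OF jump(1) tX] jump by (intro add_left_mono mult_right_mono) auto
        also have "\<dots> = D ?s"
          using delta_derivative_jump[OF deriv jump(1)] in_kappaI[OF jump(1) X tX] by simp
        finally show "- e * E ?s \<le> D ?s" .
      qed
    next
      case (dense t)
      show ?case
      proof (cases "t < X")
        case False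
        then show ?thesis by (intro exI[of _ 1]) auto
      next
        case tX: True
        note d = deriv[OF in_kappaI[OF dense(1) X tX]]
        have ge: "- e * E t \<le> D t" using dense tX by simp
        show ?thesis
        \<comment> \<open>Strictly above the barrier, continuity suffices. On the barrier the
          derivative must decide.\<close>
        proof (cases "D t = - e * E t")
          case False
          then have gt: "0 < D t + e * E t" using ge by simp
          have Ec: "(E \<longlongrightarrow> E t) (at t within T)" unfolding E_def by (intro tendsto_intros)
          have "((\<lambda>s. D s + e * E s) \<longlongrightarrow> D t + e * E t) (at t within T)"
            using delta_derivative_continuous[OF d dense(1)] Ec by (intro tendsto_intros)
          from order_tendstoD(1)[OF this gt]
          obtain \<delta> where "\<delta> > 0" "\<And>s. s \<in> T \<Longrightarrow> s \<noteq> t \<Longrightarrow> dist s t < \<delta> \<Longrightarrow> 0 < D s + e * E s"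
            unfolding eventually_at by blast
          then show ?thesis by (intro exI[of _ \<delta>]) (force simp: dist_real_def)
        next
          case True
          let ?g = "e * E t"
          have g: "?g > 0" using e E by simp
          \<comment> \<open>The tolerance is the barrier height \<open>?g\<close>: the slope is at
            least - (M - 1) * \<open>?g\<close>, and the error costs one more \<open>?g\<close>, in
            total the slope - M * \<open>?g\<close> of the barrier at t.\<close>
          obtain \<delta> where \<delta>: "\<delta> > 0" "\<And>s. s \<in> T \<Longrightarrow> \<bar>s - t\<bar> < \<delta> \<Longrightarrow> \<bar>D t - D s - D' t * (t - s)\<bar> \<le> ?g * \<bar>t - s\<bar>"
            using d g dense(2) unfolding has_delta_derivative_def by auto
          have "- e * E s \<le> D s" if s: "s \<in> T" "t < s" "s < t + \<delta>" for s
          proof -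
            have "q t * D t \<le> D' t" using ineq dense tX by auto
            moreover have "q t * ?g \<le> (M - 1) * ?g"
              using q[OF dense(1) tX] g by (intro mult_right_mono) (auto simp: M_def)
            ultimately have "- (M - 1) * ?g \<le> D' t" using True by (simp add: algebra_simps)
            then have 1: "- (M - 1) * ?g * (s - t) \<le> D' t * (s - t)" using s by (intro mult_right_mono) auto
            have "\<bar>D t - D s - D' t * (t - s)\<bar> \<le> ?g * (s - t)" using \<delta>(2)[of s] s by auto
            then have "D t + D' t * (s - t) - ?g * (s - t) \<le> D s" by (simp add: algebra_simps abs_le_iff)
            then have 2: "- ?g * (1 + M * (s - t)) \<le> D s" using 1 True by (simp add: algebra_simps)
            have "E s = E t * exp (M * (s - t))" unfolding E_def exp_add[symmetric] by (simp add: algebra_simps)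
            moreover have "1 + M * (s - t) \<le> exp (M * (s - t))" by (rule exp_ge_add_one_self)
            ultimately have "?g * (1 + M * (s - t)) \<le> e * E s" using g e E[of t] by (simp add: mult.assoc)
            with 2 show ?thesis by simp
          qed
          with \<delta>(1) show ?thesis by blast
        qed
      qed
    next
      case (limit t)
      show ?case
      proof
        assume tX: "t \<le> X"
        \<comment> \<open>A left-dense point belongs to \<open>kappa T\<close> even if it is the
          greatest element, so D is continuous there.\<close>
        have "(D \<longlongrightarrow> D t) (at t within T)"
          using delta_derivative_continuous[OF deriv limit(1)] left_dense_in_kappa limit by auto
        then have D: "(D \<longlongrightarrow> D t) (at t within {s \<in> T. s < t})" by (rule tendsto_within_subset) auto
        have Ec: "((\<lambda>s. - e * E s) \<longlongrightarrow> - e * E t) (at t within {s \<in> T. s < t})"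
          unfolding E_def by (intro tendsto_intros)
        have "at t within {s \<in> T. s < t} \<noteq> bot"
          using limit(2) unfolding left_dense_def trivial_limit_within by simp
        then show "- e * E t \<le> D t" using D Ec
          by (rule tendsto_le) (use limit(3) tX in \<open>auto simp: eventually_at_filter\<close>)
      qed
    qed
    then show ?thesis using X by simp
  qed
  have "- D X \<le> 0 + e" if "e > 0" for e
    using bound[of "e / E X"] that E[of X] by simp
  then have "- D X \<le> 0" by (rule field_le_epsilon)
  then show ?thesis by simp
qed

text \<open>The comparison principle is applied to both differences. With q = 0 this gives
  uniqueness of antiderivatives, with g = 0 uniqueness of the exponential.\<close>

lemma delta_linear_unique:
  assumes F: "\<And>t. t \<in> kappa T \<Longrightarrow> has_delta_derivative T F (g t + q t * F t) t"
    and G: "\<And>t. t \<in> kappa T \<Longrightarrow> has_delta_derivative T G (g t + q t * G t) t"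
    and q: "\<And>t. t \<in> T \<Longrightarrow> t < X \<Longrightarrow> 0 \<le> q t \<and> q t \<le> K"
    and init: "F x0 = G x0" and X: "X \<in> T"
  shows "F X = G X"
proof (rule antisym)
  have le: "F X \<le> G X"
    if F: "\<And>t. t \<in> kappa T \<Longrightarrow> has_delta_derivative T F (g t + q t * F t) t"
      and G: "\<And>t. t \<in> kappa T \<Longrightarrow> has_delta_derivative T G (g t + q t * G t) t"
      and init: "F x0 = G x0" for F G
  proof -
    have "0 \<le> 0 + (-1) * F X + 1 * G X"
      by (rule delta_comparison[OF delta_derivative_lincomb[OF F G] _ q _ X])
        (use init in \<open>auto simp: algebra_simps\<close>)
    then show ?thesis by simp
  qed
  show "F X \<le> G X" by (rule le[OF F G init])
  show "G X \<le> F X" by (rule le[OF G F init[symmetric]])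
qed

end

section \<open>Delta integrals as ordinary integrals\<close>

text \<open>One-sided limits bound h on an interval around each point, and the bisection principle
  \<open>Bolzano\<close> glues the bounds.\<close>

lemma regulated_bounded:
  fixes h :: "real \<Rightarrow> real"
  assumes R: "\<And>s. \<exists>L. (h \<longlongrightarrow> L) (at_right s)" and L: "\<And>s. \<exists>L. (h \<longlongrightarrow> L) (at_left s)"
  shows "\<exists>B. \<forall>s\<in>{c..d}. \<bar>h s\<bar> \<le> B"
proof (cases "c \<le> d")
  case True
  then show ?thesis
  proof (induction rule: Bolzano)
    case (trans a b c)
    then obtain B1 B2 where "\<forall>s\<in>{a..b}. \<bar>h s\<bar> \<le> B1" "\<forall>s\<in>{b..c}. \<bar>h s\<bar> \<le> B2" by blast
    then have "\<bar>h s\<bar> \<le> max B1 B2" if "s \<in> {a..c}" for s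
      using that by (cases "s \<le> b") (auto intro: max.coboundedI1 max.coboundedI2)
    then show ?case by blast
  next
    case (local x)
    obtain r where r: "(h \<longlongrightarrow> r) (at_right x)" using R by blast
    obtain l where l: "(h \<longlongrightarrow> l) (at_left x)" using L by blast
    obtain b where b: "b > x" "\<And>s. x < s \<Longrightarrow> s < b \<Longrightarrow> dist (h s) r < 1"
      using tendstoD[OF r zero_less_one] unfolding eventually_at_right_field by blast
    obtain a where a: "a < x" "\<And>s. a < s \<Longrightarrow> s < x \<Longrightarrow> dist (h s) l < 1"
      using tendstoD[OF l zero_less_one] unfolding eventually_at_left_field by blast
    have "\<bar>h s\<bar> \<le> \<bar>l\<bar> + \<bar>r\<bar> + \<bar>h x\<bar> + 1" if "a < s" "s < b" for s
      using a(2)[of s] b(2)[of s] that by (cases s x rule: linorder_cases) (auto simp: dist_real_def)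
    then show ?case
      using a b by (intro exI[of _ "min (x - a) (b - x)"]) (auto intro!: exI[of _ "\<bar>l\<bar> + \<bar>r\<bar> + \<bar>h x\<bar> + 1"])
  qed
qed auto

text \<open>Around each point h is uniformly close to a function with one value on each side and h x
  in the middle. Gluing by bisection gives integrable uniform approximations on the whole
  interval.\<close>

lemma regulated_integrable:
  fixes h :: "real \<Rightarrow> real"
  assumes R: "\<And>s. \<exists>L. (h \<longlongrightarrow> L) (at_right s)" and L: "\<And>s. \<exists>L. (h \<longlongrightarrow> L) (at_left s)"
  shows "h integrable_on {c..d}"
proof (cases "c \<le> d")
  case True
  have "\<exists>k. (\<forall>s\<in>{c..d}. norm (h s - k s) \<le> e) \<and> k integrable_on {c..d}" if e: "e > 0" for e
    using True
  proof (induction rule: Bolzano)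
    case (trans a b c)
    then obtain k1 k2 where k1: "\<forall>s\<in>{a..b}. norm (h s - k1 s) \<le> e" "k1 integrable_on {a..b}"
      and k2: "\<forall>s\<in>{b..c}. norm (h s - k2 s) \<le> e" "k2 integrable_on {b..c}" by blast
    let ?k = "\<lambda>s. if s \<le> b then k1 s else k2 s"
    have "?k integrable_on {a..b}" by (rule integrable_eq[OF k1(2)]) auto
    moreover have "?k integrable_on {b..c}"
      by (rule integrable_spike_finite[OF _ _ k2(2), of "{b}"]) auto
    ultimately have "?k integrable_on {a..c}"
      by (rule Henstock_Kurzweil_Integration.integrable_combine[OF trans(3,4)])
    then show ?case using k1 k2 by (intro exI[of _ ?k]) auto
  next
    case (local x)
    obtain r where r: "(h \<longlongrightarrow> r) (at_right x)" using R by blast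
    obtain l where l: "(h \<longlongrightarrow> l) (at_left x)" using L by blast
    obtain b where b: "b > x" "\<And>s. x < s \<Longrightarrow> s < b \<Longrightarrow> dist (h s) r < e"
      using tendstoD[OF r e] unfolding eventually_at_right_field by blast
    obtain a where a: "a < x" "\<And>s. a < s \<Longrightarrow> s < x \<Longrightarrow> dist (h s) l < e"
      using tendstoD[OF l e] unfolding eventually_at_left_field by blast
    let ?k = "\<lambda>s. if s < x then l else if s = x then h x else r"
    have "?k integrable_on {c..d}" if "c \<le> x" "x \<le> d" for c d
    proof -
      have "?k integrable_on {c..x}"
        by (rule integrable_spike_finite[of "{x}" _ _ "\<lambda>_. l"]) auto
      moreover have "?k integrable_on {x..d}"
        by (rule integrable_spike_finite[of "{x}" _ _ "\<lambda>_. r"]) auto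
      ultimately show ?thesis
        by (rule Henstock_Kurzweil_Integration.integrable_combine[OF that])
    qed
    moreover have "norm (h s - ?k s) \<le> e" if "a < s" "s < b" for s
      using a(2)[of s] b(2)[of s] that e by (auto simp: dist_real_def)
    ultimately show ?case
      using a b by (intro exI[of _ "min (x - a) (b - x)"] conjI allI impI exI[of _ ?k]) auto
  qed
  then show ?thesis using integrable_uniform_limit[of c d h] by simp
qed auto

text \<open>The exceptional set S serves for the right end of a gap, where the floor map jumps. With
  e = 0 the integral over a gap is computed exactly; with k = 0 the lemma is a plain bound.\<close>

lemma integral_near_const:
  fixes h :: "real \<Rightarrow> real"
  assumes h: "h integrable_on {c..d}" and "c \<le> d" "finite S" "0 \<le> e"
    and le: "\<And>s. s \<in> {c..d} - S \<Longrightarrow> \<bar>h s - k\<bar> \<le> e"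
  shows "\<bar>integral {c..d} h - k * (d - c)\<bar> \<le> e * (d - c)"
proof -
  have "((\<lambda>s. h s - k) has_integral integral {c..d} h - (d - c) *\<^sub>R k) (cbox c d)"
    using has_integral_diff[OF integrable_integral[OF h] has_integral_const_real[of k c d]] \<open>c \<le> d\<close> by simp
  from has_integral_bound_spike_finite[OF \<open>0 \<le> e\<close> \<open>finite S\<close> this] le
  show ?thesis using \<open>c \<le> d\<close> by (simp add: mult.commute)
qed

text \<open>Phrased with \<open>approach_sets\<close>, like the joint notion, so that sections of a
  jointly rd-continuous function satisfy it directly.\<close>

definition rd_continuous1 :: "real set \<Rightarrow> (real \<Rightarrow> real) \<Rightarrow> bool" where
  "rd_continuous1 X g \<longleftrightarrow>
     (\<forall>t\<in>X. \<forall>E\<in>approach_sets X t. \<exists>L. (g \<longlongrightarrow> L) (at t within E) \<and> (t \<in> E \<longrightarrow> L = g t))"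

text \<open>On a gap from t up to, but excluding, \<open>sigma T t\<close> the value is t, so the
  ordinary integral of g after this map over the gap is g t times its length, as the delta
  derivative demands. Below the least element of T the value is the constant \<open>Sup {}\<close>,
  so one-sided limits exist on the whole line.\<close>

definition floor_in :: "real set \<Rightarrow> real \<Rightarrow> real" where
  "floor_in T s = Sup {t \<in> T. t \<le> s}"

lemma rd_continuous1_mult:
  assumes "rd_continuous1 X g" "rd_continuous1 X h"
  shows "rd_continuous1 X (\<lambda>t. g t * h t)"
  unfolding rd_continuous1_def
proof (intro ballI)
  fix t E assume t: "t \<in> X" "E \<in> approach_sets X t"
  obtain l where "(g \<longlongrightarrow> l) (at t within E)" "t \<in> E \<longrightarrow> l = g t"
    using assms t unfolding rd_continuous1_def by blast
  moreover obtain m where "(h \<longlongrightarrow> m) (at t within E)" "t \<in> E \<longrightarrow> m = h t"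
    using assms t unfolding rd_continuous1_def by blast
  ultimately show "\<exists>L. ((\<lambda>t. g t * h t) \<longlongrightarrow> L) (at t within E) \<and> (t \<in> E \<longrightarrow> L = g t * h t)"
    by (auto intro!: exI[of _ "l * m"] tendsto_intros)
qed

lemma approach_sets_subset: "t \<in> X \<Longrightarrow> E \<in> approach_sets X t \<Longrightarrow> E \<subseteq> X"
  unfolding approach_sets_def by (auto split: if_splits)

lemma continuous_imp_rd_continuous1:
  assumes "continuous_on X g"
  shows "rd_continuous1 X g"
  unfolding rd_continuous1_def
proof (intro ballI exI[of _ "g _"] conjI impI)
  fix t E assume "t \<in> X" "E \<in> approach_sets X t"
  then show "(g \<longlongrightarrow> g t) (at t within E)"
    using assms approach_sets_subset unfolding continuous_on_def by (blast intro: tendsto_within_subset)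
qed simp

lemma rd_continuous1_right:
  assumes "rd_continuous1 T g" "t \<in> T" "sigma T t = t"
  shows "(g \<longlongrightarrow> g t) (at t within T)"
proof -
  have "T \<in> approach_sets T t" using assms by (simp add: approach_sets_def right_dense_def)
  then obtain L where "(g \<longlongrightarrow> L) (at t within T)" "L = g t"
    using assms unfolding rd_continuous1_def by blast
  then show ?thesis by simp
qed

text \<open>A right-dense point has T as its only approach set, so there the left limit comes from
  restricting the full one.\<close>

lemma rd_continuous1_left:
  assumes "rd_continuous1 T g" "t \<in> T" "left_dense T t"
  shows "\<exists>L. (g \<longlongrightarrow> L) (at t within {s \<in> T. s < t})"
proof (cases "sigma T t = t")
  case True
  have "(g \<longlongrightarrow> g t) (at t within {s \<in> T. s < t})"
    by (rule tendsto_within_subset[OF rd_continuous1_right[OF assms(1,2) True]]) auto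
  then show ?thesis by blast
next
  case False
  then have "{s \<in> T. s < t} \<in> approach_sets T t" using assms by (simp add: approach_sets_def right_dense_def)
  then show ?thesis using assms unfolding rd_continuous1_def by blast
qed

section \<open>The floor map and the fundamental theorem for delta integrals\<close>

context based_time_scale
begin

lemma floor_in:
  assumes "x0 \<le> s"
  shows floor_in_in: "floor_in T s \<in> T" and floor_in_le: "floor_in T s \<le> s"
    and floor_in_ge: "\<And>t. t \<in> T \<Longrightarrow> t \<le> s \<Longrightarrow> t \<le> floor_in T s"
proof -
  let ?L = "{t \<in> T. t \<le> s}"
  have ne: "?L \<noteq> {}" using x0_in assms by auto
  have bdd: "bdd_above ?L" by (auto intro!: bdd_aboveI[of _ s])
  have "Sup ?L \<in> closure ?L" using ne bdd by (rule closure_contains_Sup)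
  also have "closure ?L \<subseteq> T" using closed_T by (intro closure_minimal) auto
  finally show "floor_in T s \<in> T" unfolding floor_in_def .
  show "floor_in T s \<le> s" unfolding floor_in_def using ne by (intro cSup_least) auto
  show "t \<le> floor_in T s" if "t \<in> T" "t \<le> s" for t
    unfolding floor_in_def using that bdd by (intro cSup_upper) auto
qed

lemma floor_in_id: "t \<in> T \<Longrightarrow> floor_in T t = t"
  using floor_in[OF x0_le] by (intro antisym) auto

text \<open>On each side of s there are two cases. If T accumulates at s from that side, the floor
  of a nearby x is a point of T close to s, and rd-continuity applies. Otherwise the floor is
  constant near s on that side.\<close>

lemma floor_in_limits:
  assumes g: "rd_continuous1 T g"
  shows "\<exists>L. ((\<lambda>s. g (floor_in T s)) \<longlongrightarrow> L) (at_right s)"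
    and "\<exists>L. ((\<lambda>s. g (floor_in T s)) \<longlongrightarrow> L) (at_left s)"
proof -
  let ?h = "\<lambda>s. g (floor_in T s)"
  show "\<exists>L. (?h \<longlongrightarrow> L) (at_right s)"
  proof (cases "s islimpt {t \<in> T. s < t}")
    case True
    note s = sigma_eq_if_islimpt[OF True]
    have "(?h \<longlongrightarrow> g s) (at_right s)"
    proof (rule tendstoI)
      fix e :: real assume e: "e > 0"
      obtain d where d: "d > 0" "\<And>x. x \<in> T \<Longrightarrow> x \<noteq> s \<Longrightarrow> dist x s < d \<Longrightarrow> dist (g x) (g s) < e"
        using tendstoD[OF rd_continuous1_right[OF g s(2,1)] e] unfolding eventually_at by blast
      have "dist (?h x) (g s) < e" if x: "s < x" "x < s + d" for x
      proof (cases "floor_in T x = s")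
        case False
        have "x0 \<le> x" using x0_le[OF s(2)] x by simp
        from floor_in[OF this] s(2) x False d(2)[of "floor_in T x"] show ?thesis by (force simp: dist_real_def)
      qed (use e in auto)
      then show "\<forall>\<^sub>F x in at_right s. dist (?h x) (g s) < e"
        unfolding eventually_at_right_field using d(1) by (intro exI[of _ "s + d"]) auto
    qed
    then show ?thesis by blast
  next
    case False
    then obtain d where d: "d > 0" "\<And>t. t \<in> T \<Longrightarrow> s < t \<Longrightarrow> s + d \<le> t"
      unfolding islimpt_approachable by (force simp: dist_real_def)
    have "floor_in T x = floor_in T s" if "s < x" "x < s + d" for x
      unfolding floor_in_def using that d(2) by (intro arg_cong[of _ _ Sup]) force
    then have "\<forall>\<^sub>F x in at_right s. ?h x = ?h s"
      unfolding eventually_at_right_field using d(1) by (intro exI[of _ "s + d"]) auto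
    then show ?thesis by (intro exI[of _ "?h s"] tendsto_eventually)
  qed
  show "\<exists>L. (?h \<longlongrightarrow> L) (at_left s)"
  proof (cases "left_dense T s")
    case True
    have "s \<in> T"
      using islimpt_subset[OF True[unfolded left_dense_def], of T] closed_T unfolding closed_limpt by auto
    from rd_continuous1_left[OF g this True]
    obtain L where L: "(g \<longlongrightarrow> L) (at s within {t \<in> T. t < s})" by blast
    have "(?h \<longlongrightarrow> L) (at_left s)"
    proof (rule tendstoI)
      fix e :: real assume e: "e > 0"
      obtain d where d: "d > 0"
          "\<And>x. x \<in> {t \<in> T. t < s} \<Longrightarrow> x \<noteq> s \<Longrightarrow> dist x s < d \<Longrightarrow> dist (g x) L < e"
        using tendstoD[OF L e] unfolding eventually_at by blast
      \<comment> \<open>For x between \<open>r\<close> and s the floor also lies between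
        \<open>r\<close> and s, hence within d of s, and it differs from s.\<close>
      obtain r where r: "r \<in> T" "r < s" "dist r s < d"
        using True d(1) unfolding left_dense_def islimpt_approachable by blast
      have "dist (?h x) L < e" if x: "r < x" "x < s" for x
      proof -
        have "x0 \<le> x" using x0_le[OF r(1)] x by simp
        from floor_in[OF this] r x d(2)[of "floor_in T x"] show ?thesis by (force simp: dist_real_def)
      qed
      then show "\<forall>\<^sub>F x in at_left s. dist (?h x) L < e"
        unfolding eventually_at_left_field using r(2) by blast
    qed
    then show ?thesis by blast
  next
    case False
    then obtain d where d: "d > 0" "\<And>t. t \<in> T \<Longrightarrow> t < s \<Longrightarrow> t \<le> s - d"
      unfolding left_dense_def islimpt_approachable by (force simp: dist_real_def)
    have "floor_in T x = floor_in T (s - d)" if "s - d < x" "x < s" for x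
      unfolding floor_in_def using that d(2) by (intro arg_cong[of _ _ Sup]) force
    then have "\<forall>\<^sub>F x in at_left s. ?h x = ?h (s - d)"
      unfolding eventually_at_left_field using d(1) by (intro exI[of _ "s - d"]) auto
    then show ?thesis by (intro exI[of _ "?h (s - d)"] tendsto_eventually)
  qed
qed

lemma rd_integrable:
  "rd_continuous1 T g \<Longrightarrow> (\<lambda>s. g (floor_in T s)) integrable_on {c..d}"
  by (intro regulated_integrable floor_in_limits)

lemma rd_bounded:
  assumes "rd_continuous1 T g"
  shows "\<exists>B. \<forall>t\<in>T. t \<le> X \<longrightarrow> \<bar>g t\<bar> \<le> B"
proof -
  obtain B where "\<forall>s\<in>{x0..X}. \<bar>g (floor_in T s)\<bar> \<le> B"
    using regulated_bounded[OF floor_in_limits[OF assms]] by blast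
  then show ?thesis using x0_le floor_in_id by (intro exI[of _ B]) force
qed

text \<open>If \<open>sigma T t = t\<close>, the integrand is close to g t between s and t. If t is
  right-scattered, the gap contributes exactly g t times its length; for s left of t boundedness of
  g is enough, because the permitted error is at least e times the fixed gap length.\<close>

lemma delta_derivative_integral:
  assumes g: "rd_continuous1 T g" and t: "t \<in> T"
  shows "has_delta_derivative T (\<lambda>x. integral {x0..x} (\<lambda>s. g (floor_in T s))) (g t) t"
  unfolding has_delta_derivative_def
proof (intro allI impI)
  fix e :: real assume e: "e > 0"
  let ?h = "\<lambda>s. g (floor_in T s)" and ?s = "sigma T t"
  define F where "F = (\<lambda>x. integral {x0..x} ?h)"
  have int: "?h integrable_on {c..d}" for c d by (rule rd_integrable[OF g])
  have F: "F d - F c = integral {c..d} ?h" if "x0 \<le> c" "c \<le> d" for c d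
    using Henstock_Kurzweil_Integration.integral_combine[OF that int] by (simp add: F_def)
  have "\<exists>d>0. \<forall>s\<in>T. \<bar>s - t\<bar> < d \<longrightarrow> \<bar>F ?s - F s - g t * (?s - s)\<bar> \<le> e * \<bar>?s - s\<bar>"
    using t
  proof (cases rule: sigma_cases)
    case 1
    obtain d where d: "d > 0" "\<And>x. x \<in> T \<Longrightarrow> x \<noteq> t \<Longrightarrow> dist x t < d \<Longrightarrow> dist (g x) (g t) < e"
      using tendstoD[OF rd_continuous1_right[OF g t 1] e] unfolding eventually_at by blast
    have near: "\<bar>g x - g t\<bar> \<le> e" if "x \<in> T" "\<bar>x - t\<bar> < d" for x
      using d(2)[of x] that e by (cases "x = t") (auto simp: dist_real_def)
    have key: "\<bar>F q - F p - g t * (q - p)\<bar> \<le> e * (q - p)"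
      if "p \<in> T" "q \<in> T" "p \<le> q" "\<bar>p - t\<bar> < d" "\<bar>q - t\<bar> < d" for p q
    proof -
      have "\<bar>?h x - g t\<bar> \<le> e" if x: "x \<in> {p..q}" for x
      proof (rule near)
        have "x0 \<le> x" using x0_le[OF \<open>p \<in> T\<close>] x by simp
        from floor_in[OF this] \<open>p \<in> T\<close> x
        show "floor_in T x \<in> T" "\<bar>floor_in T x - t\<bar> < d"
          using \<open>\<bar>p - t\<bar> < d\<close> \<open>\<bar>q - t\<bar> < d\<close> by force+
      qed
      then show ?thesis
        unfolding F[OF x0_le[OF that(1)] that(3)]
        using e that(3) by (intro integral_near_const[OF int, of _ _ "{}"]) auto
    qed
    have "\<bar>F t - F s - g t * (t - s)\<bar> \<le> e * \<bar>t - s\<bar>" if "s \<in> T" "\<bar>s - t\<bar> < d" for s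
      using key[of s t] key[of t s] that t d(1) by (cases "s \<le> t") (auto simp: algebra_simps abs_le_iff)
    then show ?thesis unfolding 1 using d(1) by blast
  next
    case 2
    let ?m = "?s - t"
    obtain B where B: "\<And>x. x \<in> T \<Longrightarrow> x \<le> t \<Longrightarrow> \<bar>g x\<bar> \<le> B" using rd_bounded[OF g] by blast
    have B0: "0 \<le> B" using B[OF t] by simp
    \<comment> \<open>The first bound forces s \<le> t. The second covers two errors of size at most
      B * d, the integral from s to t and g t * (t - s); the summand 1 keeps the denominator
      positive when B = 0.\<close>
    define d where "d = min ?m (e * ?m / (2 * B + 1))"
    have d: "d > 0" "d \<le> ?m" "(2 * B + 1) * d \<le> e * ?m"
      using 2 e B0 mult_left_mono[of d "e * ?m / (2 * B + 1)" "2 * B + 1"] by (auto simp: d_def)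
    have "\<bar>F ?s - F s - g t * (?s - s)\<bar> \<le> e * \<bar>?s - s\<bar>" if s: "s \<in> T" "\<bar>s - t\<bar> < d" for s
    proof -
      have st: "s \<le> t" using 2(3)[OF s(1)] s d by force
      have x0s: "x0 \<le> s" using x0_le s by blast
      have fl: "floor_in T x = t" if "x \<in> {t..?s} - {?s}" for x
      proof -
        have "x0 \<le> x" using that x0_le[OF t] by auto
        from floor_in[OF this] that t 2(3)[of "floor_in T x"] show ?thesis by force
      qed
      have "\<bar>F ?s - F t - g t * ?m\<bar> \<le> 0 * ?m"
        unfolding F[OF x0_le[OF t] sigma_ge[OF t]]
        using fl 2 by (intro integral_near_const[OF int, of _ _ "{?s}"]) auto
      then have 1: "F ?s = F t + g t * ?m" by simp
      have "\<bar>F t - F s - 0 * (t - s)\<bar> \<le> B * (t - s)"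
        unfolding F[OF x0s st]
      proof (rule integral_near_const[OF int st, of "{}"])
        fix x assume x: "x \<in> {s..t} - {}"
        then have "x0 \<le> x" using x0s by auto
        from floor_in[OF this] x B[of "floor_in T x"] show "\<bar>?h x - 0\<bar> \<le> B" by force
      qed (use B0 in auto)
      moreover have "\<bar>g t * (t - s)\<bar> \<le> B * (t - s)"
        using B[OF t] st by (auto simp: abs_mult intro!: mult_right_mono)
      moreover have "B * (t - s) \<le> B * d" using s B0 by (intro mult_left_mono) auto
      moreover have "2 * (B * d) \<le> e * ?m" using d by (simp add: algebra_simps)
      moreover have "e * ?m \<le> e * \<bar>?s - s\<bar>" using st e by (intro mult_left_mono) auto
      moreover have "F ?s - F s - g t * (?s - s) = F t - F s - g t * (t - s)"
        unfolding 1 by (simp add: algebra_simps)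
      ultimately show ?thesis by linarith
    qed
    with d(1) show ?thesis by blast
  qed
  then show "\<exists>d>0. \<forall>s\<in>T. \<bar>s - t\<bar> < d \<longrightarrow>
      \<bar>integral {x0..?s} ?h - integral {x0..s} ?h - g t * (?s - s)\<bar> \<le> e * \<bar>?s - s\<bar>"
    unfolding F_def .
qed

text \<open>The ordinary integral is one antiderivative. Any other, shifted to vanish at x0, agrees
  with it on T by \<open>delta_linear_unique\<close> with coefficient 0, so the description denotes
  its increment.\<close>

lemma delta_integral_eq:
  assumes g: "rd_continuous1 T g" and x: "x \<in> T"
  shows "delta_integral T x0 x g = integral {x0..x} (\<lambda>s. g (floor_in T s))"
  unfolding delta_integral_def
proof (rule the_equality)
  let ?F = "\<lambda>x. integral {x0..x} (\<lambda>s. g (floor_in T s))"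
  have F: "has_delta_derivative T ?F (g t) t" if "t \<in> kappa T" for t
    using that by (intro delta_derivative_integral[OF g] kappa_subset)
  then show "\<exists>F. (\<forall>t\<in>kappa T. has_delta_derivative T F (g t) t) \<and> ?F x = F x - F x0"
    by (intro exI[of _ ?F]) auto
  fix v assume "\<exists>F. (\<forall>t\<in>kappa T. has_delta_derivative T F (g t) t) \<and> v = F x - F x0"
  then obtain G where G: "\<And>t. t \<in> kappa T \<Longrightarrow> has_delta_derivative T G (g t) t" and v: "v = G x - G x0" by blast
  have "has_delta_derivative T (\<lambda>x. G x - G x0) (g t) t" if "t \<in> kappa T" for t
    using delta_derivative_lincomb[OF G G, OF that that, of "- G x0" 1 0] by simp
  then have "G x - G x0 = ?F x"
    using delta_linear_unique[of "\<lambda>x. G x - G x0" g "\<lambda>_. 0" ?F x 0] F x by simp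
  then show "v = ?F x" using v by simp
qed

end

section \<open>The exponential function by Picard iteration\<close>

context based_time_scale
begin

lemma integral_continuous:
  fixes h :: "real \<Rightarrow> real"
  assumes "\<And>c. h integrable_on {x0..c}"
  shows "continuous_on T (\<lambda>x. integral {x0..x} h)"
  unfolding continuous_on_def
proof
  fix t assume t: "t \<in> T"
  let ?F = "\<lambda>x. integral {x0..x} h"
  \<comment> \<open>The upper end t + 1 leaves room to the right of t, so that near t the interval
    cuts nothing off T.\<close>
  have "(?F \<longlongrightarrow> ?F t) (at t within {x0..t + 1})"
    using indefinite_integral_continuous_1[OF assms[of "t + 1"]] x0_le[OF t]
    unfolding continuous_on_def by auto
  then have "(?F \<longlongrightarrow> ?F t) (at t within T \<inter> {x0..t + 1})"
    by (rule tendsto_within_subset) auto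
  moreover have "at t within T \<inter> {x0..t + 1} = at t within T"
    by (rule at_within_nhd[of _ "{t - 1<..<t + 1}"]) (use x0_le in auto)
  ultimately show "(?F \<longlongrightarrow> ?F t) (at t within T)" by simp
qed

text \<open>The iterates increase and stay below an ordinary exponential, so dominated convergence
  turns their limit into a solution.\<close>

fun picard :: "(real \<Rightarrow> real) \<Rightarrow> nat \<Rightarrow> real \<Rightarrow> real" where
  "picard q 0 t = 1"
| "picard q (Suc n) t = 1 + integral {x0..t} (\<lambda>s. q (floor_in T s) * picard q n (floor_in T s))"

lemma rd_picard: "rd_continuous1 T q \<Longrightarrow> rd_continuous1 T (picard q n)"
proof (induction n)
  case 0
  have "picard q 0 = (\<lambda>_. 1)" by auto
  then show ?case by (simp add: continuous_imp_rd_continuous1)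
next
  case (Suc n)
  have eq: "picard q (Suc n) = (\<lambda>t. 1 + integral {x0..t} (\<lambda>s. q (floor_in T s) * picard q n (floor_in T s)))"
    by auto
  show ?case unfolding eq
    using rd_integrable[OF rd_continuous1_mult[OF Suc.prems Suc.IH[OF Suc.prems]]]
    by (intro continuous_imp_rd_continuous1 continuous_on_add continuous_on_const integral_continuous)
qed

text \<open>The limit w of the iterates satisfies the integral equation. Hence w is continuous on T,
  q * w is rd-continuous, and \<open>delta_derivative_integral\<close> turns the integral equation
  into the differential one.\<close>

lemma delta_exp_solution:
  assumes q: "rd_continuous1 T q" and q0: "\<And>t. t \<in> T \<Longrightarrow> 0 \<le> q t"
  obtains w where "\<And>t. t \<in> T \<Longrightarrow> has_delta_derivative T w (q t * w t) t" "w x0 = 1"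
    "\<And>t. t \<in> T \<Longrightarrow> delta_exp T q t x0 = w t"
proof -
  let ?p = "picard q" and ?r = "floor_in T"
  have int: "(\<lambda>s. q (?r s) * ?p n (?r s)) integrable_on {c..d}" for n c d
    by (rule rd_integrable[OF rd_continuous1_mult[OF q rd_picard[OF q]]])
  have mono: "0 \<le> ?p n t \<and> ?p n t \<le> ?p (Suc n) t" if "t \<in> T" for n t
    using that
  proof (induction n arbitrary: t)
    case 0
    have "0 \<le> integral {x0..t} (\<lambda>s. q (?r s) * ?p 0 (?r s))"
      using int[of 0] q0 floor_in_in by (intro integral_nonneg) auto
    then show ?case by simp
  next
    case (Suc n)
    have "integral {x0..t} (\<lambda>s. q (?r s) * ?p n (?r s)) \<le> integral {x0..t} (\<lambda>s. q (?r s) * ?p (Suc n) (?r s))"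
      using Suc.IH floor_in_in q0 by (intro integral_le int mult_left_mono) auto
    then have "?p (Suc n) t \<le> ?p (Suc (Suc n)) t" by simp
    moreover have "0 \<le> ?p (Suc n) t" using Suc.IH[OF Suc.prems] by linarith
    ultimately show ?case by blast
  qed
  have bounded: "\<exists>B. \<forall>n. \<forall>t\<in>T. t \<le> X \<longrightarrow> \<bar>q t * ?p n t\<bar> \<le> B \<and> ?p n t \<le> B" for X
  proof -
    obtain K0 where K0: "\<forall>t\<in>T. t \<le> X \<longrightarrow> \<bar>q t\<bar> \<le> K0" using rd_bounded[OF q] by blast
    \<comment> \<open>\<open>?E\<close> solves E' = K * E in the ordinary sense and dominates all
      iterates, because it increases and the floor of s is at most s. K \<ge> 1 lets the single
      constant K * \<open>?E X\<close> bound both the iterates and their products with q.\<close>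
    define K where "K = max K0 1"
    have K: "K \<ge> 1" "\<And>t. t \<in> T \<Longrightarrow> t \<le> X \<Longrightarrow> \<bar>q t\<bar> \<le> K" using K0 by (auto simp: K_def intro: max.coboundedI1)
    let ?E = "\<lambda>s. exp (K * (s - x0))"
    have le: "?p n t \<le> ?E t" if "t \<in> T" "t \<le> X" for n t
      using that
    proof (induction n arbitrary: t)
      case 0
      then show ?case using K x0_le by simp
    next
      case (Suc n)
      have E: "((\<lambda>s. K * ?E s) has_integral ?E t - ?E x0) {x0..t}"
        by (rule fundamental_theorem_of_calculus)
          (use x0_le Suc in \<open>auto intro!: derivative_eq_intros simp flip: has_real_derivative_iff_has_vector_derivative\<close>)
      have "integral {x0..t} (\<lambda>s. q (?r s) * ?p n (?r s)) \<le> integral {x0..t} (\<lambda>s. K * ?E s)"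
      proof (intro integral_le int has_integral_integrable[OF E])
        fix s assume s: "s \<in> {x0..t}"
        then have r: "?r s \<in> T" "?r s \<le> s" using floor_in_in floor_in_le by auto
        have "q (?r s) * ?p n (?r s) \<le> K * ?E (?r s)"
          using r s Suc K(2)[of "?r s"] mono[OF r(1), of n] by (intro mult_mono) auto
        also have "\<dots> \<le> K * ?E s" using r K by (intro mult_left_mono) auto
        finally show "q (?r s) * ?p n (?r s) \<le> K * ?E s" .
      qed
      then show ?case using integral_unique[OF E] by simp
    qed
    have "\<bar>q t * ?p n t\<bar> \<le> K * ?E X \<and> ?p n t \<le> K * ?E X" if t: "t \<in> T" "t \<le> X" for n t
    proof -
      have "?p n t \<le> ?E t" by (rule le[OF t])
      also have "\<dots> \<le> ?E X" using t K by simp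
      finally have pX: "?p n t \<le> ?E X" .
      moreover have "?p n t \<le> K * ?E X"
        using pX mult_right_mono[OF K(1) exp_ge_zero, of "K * (X - x0)"] by linarith
      moreover have "\<bar>q t\<bar> * ?p n t \<le> K * ?E X"
        using K t pX mono[OF t(1), of n] by (intro mult_mono) auto
      ultimately show ?thesis using mono[OF t(1), of n] by (auto simp: abs_mult)
    qed
    then show ?thesis by blast
  qed
  define w where "w = (\<lambda>t. lim (\<lambda>n. ?p n t))"
  have lim: "(\<lambda>n. ?p n t) \<longlonglongrightarrow> w t" if t: "t \<in> T" for t
  proof -
    obtain B where "\<And>n. ?p n t \<le> B" using bounded[of t] t by auto
    moreover have "incseq (\<lambda>n. ?p n t)" using mono[OF t] by (intro incseq_SucI) auto
    ultimately have "convergent (\<lambda>n. ?p n t)"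
      by (blast intro: incseq_convergent convergentI)
    then show ?thesis unfolding w_def by (simp add: convergent_LIMSEQ_iff)
  qed
  have dom: "(\<lambda>s. q (?r s) * w (?r s)) integrable_on {x0..c} \<and>
      (\<lambda>n. integral {x0..c} (\<lambda>s. q (?r s) * ?p n (?r s))) \<longlonglongrightarrow> integral {x0..c} (\<lambda>s. q (?r s) * w (?r s))" for c
  proof -
    obtain B where B: "\<And>n t. t \<in> T \<Longrightarrow> t \<le> c \<Longrightarrow> \<bar>q t * ?p n t\<bar> \<le> B" using bounded[of c] by blast
    have le: "norm (q (?r s) * ?p n (?r s)) \<le> B" if "s \<in> {x0..c}" for n s
      using that B[OF floor_in_in, of s n] floor_in_le[of s] by auto
    have conv: "(\<lambda>n. q (?r s) * ?p n (?r s)) \<longlonglongrightarrow> q (?r s) * w (?r s)" if "s \<in> {x0..c}" for s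
      using that lim floor_in_in by (intro tendsto_intros) auto
    show ?thesis
      using dominated_convergence[of "\<lambda>n s. q (?r s) * ?p n (?r s)" "{x0..c}" "\<lambda>_. B", OF int _ le conv] by auto
  qed
  have w_eq: "w t = 1 + integral {x0..t} (\<lambda>s. q (?r s) * w (?r s))" if "t \<in> T" for t
  proof (rule LIMSEQ_unique)
    show "(\<lambda>n. ?p (Suc n) t) \<longlonglongrightarrow> w t" using lim[OF that] by (rule LIMSEQ_Suc)
    show "(\<lambda>n. ?p (Suc n) t) \<longlonglongrightarrow> 1 + integral {x0..t} (\<lambda>s. q (?r s) * w (?r s))"
      using dom[of t] unfolding picard.simps by (intro tendsto_intros) auto
  qed
  have "continuous_on T (\<lambda>t. 1 + integral {x0..t} (\<lambda>s. q (?r s) * w (?r s)))"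
    using dom by (intro continuous_on_add continuous_on_const integral_continuous) auto
  then have "continuous_on T w" using w_eq by (simp cong: continuous_on_cong)
  then have rd: "rd_continuous1 T (\<lambda>t. q t * w t)"
    by (rule rd_continuous1_mult[OF q continuous_imp_rd_continuous1])
  have deriv: "has_delta_derivative T w (q t * w t) t" if t: "t \<in> T" for t
  proof -
    have "has_delta_derivative T (\<lambda>x. 1 + 1 * integral {x0..x} (\<lambda>s. q (?r s) * w (?r s))
        + 0 * integral {x0..x} (\<lambda>s. q (?r s) * w (?r s))) (1 * (q t * w t) + 0 * (q t * w t)) t"
      by (intro delta_derivative_lincomb delta_derivative_integral[OF rd t])
    \<comment> \<open>\<open>has_delta_derivative\<close> evaluates its function only at points of
      T, among them \<open>sigma T t\<close>, so \<open>w_eq\<close> may be used although it holds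
      on T only.\<close>
    then show ?thesis
      unfolding has_delta_derivative_def using w_eq sigma_in[OF t] by simp
  qed
  have w0: "w x0 = 1" using w_eq[OF x0_in] by simp
  have "delta_exp T q t x0 = w t" if t: "t \<in> T" for t
    unfolding delta_exp_def
  proof (rule the_equality)
    show "\<exists>v. (\<forall>s\<in>kappa T. has_delta_derivative T v (q s * v s) s) \<and> v x0 = 1 \<and> w t = v t"
      using deriv w0 kappa_subset by blast
    fix v' assume "\<exists>v. (\<forall>s\<in>kappa T. has_delta_derivative T v (q s * v s) s) \<and> v x0 = 1 \<and> v' = v t"
    then obtain v where v: "\<And>s. s \<in> kappa T \<Longrightarrow> has_delta_derivative T v (q s * v s) s" "v x0 = 1" "v' = v t" by blast
    obtain K where "\<forall>s\<in>T. s \<le> t \<longrightarrow> \<bar>q s\<bar> \<le> K" using rd_bounded[OF q] by blast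
    then have "v t = w t"
      using v deriv w0 q0 kappa_subset
      by (intro delta_linear_unique[of v "\<lambda>_. 0" q w t K, OF _ _ _ _ t]) (auto dest!: bspec)
    then show "v' = w t" using v by simp
  qed
  with that deriv w0 show thesis by blast
qed

end

section \<open>Joint rd-continuity and iterated integrals\<close>

text \<open>The limits are tested along sequences. A convergent sequence is bounded by some M, which
  yields a constant dominating function. When t is not in E, the pointwise limit L may differ from G
  t, so the limit is the integral of L.\<close>

lemma rd_continuous1_integral:
  fixes G :: "real \<Rightarrow> real \<Rightarrow> real"
  assumes int: "\<And>s. s \<in> X \<Longrightarrow> G s integrable_on {c..d}"
    and bound: "\<And>M. \<exists>B. \<forall>s\<in>X. s \<le> M \<longrightarrow> (\<forall>r\<in>{c..d}. \<bar>G s r\<bar> \<le> B)"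
    and rd: "\<And>r. r \<in> {c..d} \<Longrightarrow> rd_continuous1 X (\<lambda>s. G s r)"
  shows "rd_continuous1 X (\<lambda>s. integral {c..d} (G s))"
  unfolding rd_continuous1_def
proof (intro ballI)
  fix t E assume t: "t \<in> X" and E: "E \<in> approach_sets X t"
  have "\<forall>r\<in>{c..d}. \<exists>L. ((\<lambda>s. G s r) \<longlongrightarrow> L) (at t within E) \<and> (t \<in> E \<longrightarrow> L = G t r)"
    using rd t E unfolding rd_continuous1_def by blast
  then obtain L where L: "\<And>r. r \<in> {c..d} \<Longrightarrow> ((\<lambda>s. G s r) \<longlongrightarrow> L r) (at t within E)"
    and Lt: "\<And>r. r \<in> {c..d} \<Longrightarrow> t \<in> E \<Longrightarrow> L r = G t r" by metis
  have "((\<lambda>s. integral {c..d} (G s)) \<longlongrightarrow> integral {c..d} L) (at t within E)"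
    unfolding tendsto_at_iff_sequentially comp_def
  proof (intro allI impI)
    fix S :: "nat \<Rightarrow> real" assume S: "\<forall>i. S i \<in> E - {t}" "S \<longlonglongrightarrow> t"
    have SX: "S i \<in> X" for i using S(1) approach_sets_subset[OF t E] by auto
    obtain M where M: "\<And>i. S i \<le> M"
      using convergent_imp_Bseq[OF convergentI[OF S(2)]] unfolding Bseq_def by (auto simp: abs_le_iff)
    obtain B where B: "\<And>s r. s \<in> X \<Longrightarrow> s \<le> M \<Longrightarrow> r \<in> {c..d} \<Longrightarrow> \<bar>G s r\<bar> \<le> B" using bound[of M] by blast
    show "(\<lambda>i. integral {c..d} (G (S i))) \<longlonglongrightarrow> integral {c..d} L"
    proof (rule dominated_convergence(2))
      show "G (S i) integrable_on {c..d}" for i using int SX by blast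
      show "(\<lambda>_. B) integrable_on {c..d}" by auto
      show "norm (G (S i) r) \<le> B" if "r \<in> {c..d}" for i r using B SX M that by simp
      show "(\<lambda>i. G (S i) r) \<longlonglongrightarrow> L r" if "r \<in> {c..d}" for r
        using L[OF that] S unfolding tendsto_at_iff_sequentially comp_def by blast
    qed
  qed
  moreover have "integral {c..d} L = integral {c..d} (G t)" if "t \<in> E"
    using Lt that by (intro integral_cong) auto
  ultimately show "\<exists>l. ((\<lambda>s. integral {c..d} (G s)) \<longlongrightarrow> l) (at t within E) \<and> (t \<in> E \<longrightarrow> l = integral {c..d} (G t))"
    by blast
qed

lemma rd_continuous1_cong:
  assumes "rd_continuous1 X g" and eq: "\<And>t. t \<in> X \<Longrightarrow> g t = h t"
  shows "rd_continuous1 X h"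
  unfolding rd_continuous1_def
proof (intro ballI)
  fix t E assume t: "t \<in> X" and E: "E \<in> approach_sets X t"
  then obtain L where L: "(g \<longlongrightarrow> L) (at t within E)" "t \<in> E \<longrightarrow> L = g t"
    using assms unfolding rd_continuous1_def by blast
  have "(h \<longlongrightarrow> L) (at t within E)"
    by (rule Lim_transform_eventually[OF L(1)])
      (use eq approach_sets_subset[OF t E] in \<open>auto simp: eventually_at_filter intro!: always_eventually\<close>)
  then show "\<exists>L. (h \<longlongrightarrow> L) (at t within E) \<and> (t \<in> E \<longrightarrow> L = h t)" using L(2) eq[OF t] by auto
qed

lemma approach_set_containing: "\<exists>E\<in>approach_sets X t. t \<in> E" if "t \<in> X"
  using that unfolding approach_sets_def by auto

lemma rd_continuous3_mult:
  assumes "rd_continuous3 X1 X2 X3 g" "rd_continuous3 X1 X2 X3 h"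
  shows "rd_continuous3 X1 X2 X3 (\<lambda>p. g p * h p)"
  unfolding rd_continuous3_def
proof (intro ballI)
  fix t1 t2 t3 E1 E2 E3
  assume t: "t1 \<in> X1" "t2 \<in> X2" "t3 \<in> X3"
    and E: "E1 \<in> approach_sets X1 t1" "E2 \<in> approach_sets X2 t2" "E3 \<in> approach_sets X3 t3"
  let ?P = "(t1, t2, t3)" and ?E = "E1 \<times> E2 \<times> E3"
  obtain l where "(g \<longlongrightarrow> l) (at ?P within ?E)" "?P \<in> ?E \<longrightarrow> l = g ?P"
    using assms(1)[unfolded rd_continuous3_def, rule_format, OF t E] by blast
  moreover obtain m where "(h \<longlongrightarrow> m) (at ?P within ?E)" "?P \<in> ?E \<longrightarrow> m = h ?P"
    using assms(2)[unfolded rd_continuous3_def, rule_format, OF t E] by blast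
  ultimately show "\<exists>L. ((\<lambda>p. g p * h p) \<longlongrightarrow> L) (at ?P within ?E) \<and> (?P \<in> ?E \<longrightarrow> L = g ?P * h ?P)"
    by (intro exI[of _ "l * m"] conjI tendsto_mult) auto
qed

text \<open>The joint limit is composed with the map inserting one coordinate. This map is
  continuous, carries an approach set into a product of approach sets, and is injective, so
  punctured neighbourhoods stay punctured.\<close>

lemma rd_continuous3_section:
  assumes h: "rd_continuous3 X1 X2 X3 h" and t: "t1 \<in> X1" "t2 \<in> X2" "t3 \<in> X3"
  shows rd_continuous3_section1: "rd_continuous1 X1 (\<lambda>s. h (s, t2, t3))"
    and rd_continuous3_section2: "rd_continuous1 X2 (\<lambda>s. h (t1, s, t3))"
    and rd_continuous3_section3: "rd_continuous1 X3 (\<lambda>s. h (t1, t2, s))"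
proof -
  have *: "\<exists>L. ((\<lambda>s. h (\<phi> s)) \<longlongrightarrow> L) (at r within E) \<and> (r \<in> E \<longrightarrow> L = h (\<phi> r))"
    if t: "t1 \<in> X1" "t2 \<in> X2" "t3 \<in> X3"
      and E: "E1 \<in> approach_sets X1 t1" "E2 \<in> approach_sets X2 t2" "E3 \<in> approach_sets X3 t3"
      and \<phi>: "isCont \<phi> r" "\<phi> r = (t1, t2, t3)" "\<And>s. s \<in> E \<Longrightarrow> \<phi> s \<in> E1 \<times> E2 \<times> E3" "inj \<phi>"
    for t1 t2 t3 E1 E2 E3 r E and \<phi> :: "real \<Rightarrow> real \<times> real \<times> real"
  proof -
    obtain L where L: "(h \<longlongrightarrow> L) (at (\<phi> r) within E1 \<times> E2 \<times> E3)" "\<phi> r \<in> E1 \<times> E2 \<times> E3 \<longrightarrow> L = h (\<phi> r)"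
      using h[unfolded rd_continuous3_def, rule_format, OF t E] unfolding \<phi>(2) by blast
    have "filterlim \<phi> (at (\<phi> r) within E1 \<times> E2 \<times> E3) (at r within E)"
      unfolding filterlim_at
    proof
      show "\<forall>\<^sub>F s in at r within E. \<phi> s \<in> E1 \<times> E2 \<times> E3 \<and> \<phi> s \<noteq> \<phi> r"
        using \<phi>(3,4) unfolding eventually_at_filter by (auto simp: inj_eq)
      show "(\<phi> \<longlongrightarrow> \<phi> r) (at r within E)"
        using \<phi>(1) unfolding isCont_def by (rule tendsto_within_subset) auto
    qed
    from filterlim_compose[OF L(1) this] L(2) \<phi>(3) show ?thesis by blast
  qed
  obtain F1 F2 F3 where F: "F1 \<in> approach_sets X1 t1" "F2 \<in> approach_sets X2 t2" "F3 \<in> approach_sets X3 t3"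
    "t1 \<in> F1" "t2 \<in> F2" "t3 \<in> F3"
    using t by (meson approach_set_containing)
  show "rd_continuous1 X1 (\<lambda>s. h (s, t2, t3))"
    unfolding rd_continuous1_def
    by (intro ballI, rule *[OF _ t(2,3) _ F(2,3)]) (use F in \<open>auto intro!: continuous_intros injI\<close>)
  show "rd_continuous1 X2 (\<lambda>s. h (t1, s, t3))"
    unfolding rd_continuous1_def
    by (intro ballI, rule *[OF t(1) _ t(3) F(1) _ F(3)]) (use F in \<open>auto intro!: continuous_intros injI\<close>)
  show "rd_continuous1 X3 (\<lambda>s. h (t1, t2, s))"
    unfolding rd_continuous1_def
    by (intro ballI, rule *[OF t(1,2) _ F(1,2)]) (use F in \<open>auto intro!: continuous_intros injI\<close>)
qed

lemma compact_locally_bounded: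
  fixes h :: "'a::topological_space \<Rightarrow> real"
  assumes "compact K" and loc: "\<And>P. P \<in> K \<Longrightarrow> \<exists>U B. open U \<and> P \<in> U \<and> (\<forall>p\<in>U \<inter> K. \<bar>h p\<bar> \<le> B)"
  shows "\<exists>B. \<forall>p\<in>K. \<bar>h p\<bar> \<le> B"
proof -
  obtain U B where U: "\<And>P. P \<in> K \<Longrightarrow> open (U P)" "\<And>P. P \<in> K \<Longrightarrow> P \<in> U P"
    and B: "\<And>P p. P \<in> K \<Longrightarrow> p \<in> U P \<inter> K \<Longrightarrow> \<bar>h p\<bar> \<le> B P"
    using loc by metis
  obtain C where C: "C \<subseteq> K" "finite C" "K \<subseteq> (\<Union>P\<in>C. U P)"
    using compactE_image[OF \<open>compact K\<close>, of K U] U by blast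
  have "\<bar>h p\<bar> \<le> (\<Sum>P\<in>C. \<bar>B P\<bar>)" if p: "p \<in> K" for p
  proof -
    obtain P where P: "P \<in> C" "p \<in> U P" using C p by blast
    then have "\<bar>h p\<bar> \<le> \<bar>B P\<bar>" using B[of P p] C p by force
    also have "\<dots> \<le> (\<Sum>P\<in>C. \<bar>B P\<bar>)" using C P by (intro member_le_sum) auto
    finally show ?thesis .
  qed
  then show ?thesis by blast
qed

lemma finite_approach_sets: "finite (approach_sets X t)"
  unfolding approach_sets_def by auto

text \<open>Just to the right of a right-scattered t there are no points of T; those just to the
  left either form an approach set or are absent. So the limits along approach sets control a
  function on a full neighbourhood of t in T.\<close>

lemma (in based_time_scale) approach_sets_cover:
  assumes t: "t \<in> T"
  shows "\<exists>S. open S \<and> t \<in> S \<and> T \<inter> S \<subseteq> \<Union>(approach_sets T t)"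
  using t
proof (cases rule: sigma_cases)
  case 1
  then show ?thesis by (intro exI[of _ UNIV]) (auto simp: approach_sets_def right_dense_def)
next
  case 2
  have sets: "approach_sets T t = {{t}} \<union> (if left_dense T t then {{s \<in> T. s < t}} else {})"
    using 2 by (simp add: approach_sets_def right_dense_def)
  show ?thesis
  proof (cases "left_dense T t")
    case True
    have "T \<inter> {..<sigma T t} \<subseteq> \<Union>(approach_sets T t)"
      unfolding sets using True 2(3) by force
    with 2 show ?thesis by (intro exI[of _ "{..<sigma T t}"]) auto
  next
    case False
    then obtain S where S: "open S" "t \<in> S" "\<And>s. s \<in> T \<Longrightarrow> s < t \<Longrightarrow> s \<notin> S"
      unfolding left_dense_def islimpt_def by blast
    have "T \<inter> (S \<inter> {..<sigma T t}) \<subseteq> \<Union>(approach_sets T t)"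
      unfolding sets using S 2(3) by force
    with 2 S show ?thesis by (intro exI[of _ "S \<inter> {..<sigma T t}"]) auto
  qed
qed

lemma based_time_scale_interval: "a \<le> b \<Longrightarrow> based_time_scale {a..b} a"
  by unfold_locales auto

text \<open>Every point of a real interval is right-dense: the right end by the convention for the
  empty infimum, the others because a midpoint would lie inside the gap.\<close>

lemma rd_continuous1_interval:
  assumes "a \<le> b" "rd_continuous1 {a..b} g"
  shows "continuous_on {a..b} g"
proof -
  interpret based_time_scale "{a..b}" a by (rule based_time_scale_interval[OF assms(1)])
  have "sigma {a..b} t = t" if "t \<in> {a..b}" for t
    using that
  proof (cases rule: sigma_cases)
    case 2
    have "sigma {a..b} t \<le> (t + sigma {a..b} t) / 2" using 2 that by (intro 2(3)) auto
    with 2 show ?thesis by simp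
  qed
  then show ?thesis
    unfolding continuous_on_def using rd_continuous1_right[OF assms(2)] by blast
qed

section \<open>Boundedness of jointly rd-continuous functions\<close>

locale two_time_scales = X: based_time_scale T1 x0 + Y: based_time_scale T2 y0
  for T1 x0 T2 y0 +
  fixes a b :: real
  assumes ab: "a < b"
begin

text \<open>Finitely many products of approach sets cover the domain near P, and on each of them the
  limit at P gives a bound near P.\<close>

lemma rd_continuous3_locally_bounded:
  assumes h: "rd_continuous3 T1 T2 {a..b} h" and P: "P \<in> T1 \<times> T2 \<times> {a..b}"
  shows "\<exists>U B. open U \<and> P \<in> U \<and> (\<forall>p\<in>U \<inter> (T1 \<times> T2 \<times> {a..b}). \<bar>h p\<bar> \<le> B)"
proof -
  interpret I: based_time_scale "{a..b}" a using ab by (intro based_time_scale_interval) simp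
  obtain t1 t2 t3 where P_eq: "P = (t1, t2, t3)" and t: "t1 \<in> T1" "t2 \<in> T2" "t3 \<in> {a..b}"
    using P by auto
  obtain S1 where S1: "open S1" "t1 \<in> S1" "T1 \<inter> S1 \<subseteq> \<Union>(approach_sets T1 t1)"
    using X.approach_sets_cover[OF t(1)] by blast
  obtain S2 where S2: "open S2" "t2 \<in> S2" "T2 \<inter> S2 \<subseteq> \<Union>(approach_sets T2 t2)"
    using Y.approach_sets_cover[OF t(2)] by blast
  obtain S3 where S3: "open S3" "t3 \<in> S3" "{a..b} \<inter> S3 \<subseteq> \<Union>(approach_sets {a..b} t3)"
    using I.approach_sets_cover[OF t(3)] by blast
  define A where "A = (\<lambda>(E1, E2, E3). E1 \<times> E2 \<times> E3) `
    (approach_sets T1 t1 \<times> approach_sets T2 t2 \<times> approach_sets {a..b} t3)"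
  have finA: "finite A" unfolding A_def by (intro finite_imageI finite_cartesian_product finite_approach_sets)
  have "\<exists>B. \<forall>\<^sub>F p in at P within E. \<bar>h p\<bar> < B" if E: "E \<in> A" for E
  proof -
    obtain E1 E2 E3 where E': "E1 \<in> approach_sets T1 t1" "E2 \<in> approach_sets T2 t2" "E3 \<in> approach_sets {a..b} t3"
      and "E = E1 \<times> E2 \<times> E3"
      using E unfolding A_def by auto
    then obtain L where "(h \<longlongrightarrow> L) (at P within E)"
      using h[unfolded rd_continuous3_def, rule_format, OF t E'] unfolding P_eq by blast
    then have "((\<lambda>p. \<bar>h p\<bar>) \<longlongrightarrow> \<bar>L\<bar>) (at P within E)" by (rule tendsto_rabs)
    from order_tendstoD(2)[OF this, of "\<bar>L\<bar> + 1"] show ?thesis by auto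
  qed
  then obtain B where B: "\<And>E. E \<in> A \<Longrightarrow> \<forall>\<^sub>F p in at P within E. \<bar>h p\<bar> < B E" by metis
  \<comment> \<open>The limits are punctured, so the value at P itself has to be added.\<close>
  define M where "M = \<bar>h P\<bar> + (\<Sum>E\<in>A. \<bar>B E\<bar>)"
  have M: "\<bar>h P\<bar> \<le> M" unfolding M_def by (simp add: sum_nonneg)
  have BM: "B E \<le> M" if "E \<in> A" for E
    using member_le_sum[of E A "\<lambda>E. \<bar>B E\<bar>"] finA that unfolding M_def by auto
  have "\<forall>\<^sub>F p in nhds P. \<forall>E\<in>A. p \<in> E \<longrightarrow> \<bar>h p\<bar> \<le> M"
  proof (rule eventually_ball_finite[OF finA], intro ballI)
    fix E assume E: "E \<in> A"
    show "\<forall>\<^sub>F p in nhds P. p \<in> E \<longrightarrow> \<bar>h p\<bar> \<le> M"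
      using B[OF E] unfolding eventually_at_filter
      by (rule eventually_mono) (use M BM[OF E] in force)
  qed
  then obtain U where U: "open U" "P \<in> U" "\<And>p E. p \<in> U \<Longrightarrow> E \<in> A \<Longrightarrow> p \<in> E \<Longrightarrow> \<bar>h p\<bar> \<le> M"
    unfolding eventually_nhds by blast
  have "\<exists>E\<in>A. p \<in> E" if p: "p \<in> S1 \<times> S2 \<times> S3" "p \<in> T1 \<times> T2 \<times> {a..b}" for p
  proof -
    obtain r1 r2 r3 where r: "p = (r1, r2, r3)" by (cases p)
    obtain E1 where "E1 \<in> approach_sets T1 t1" "r1 \<in> E1" using p S1 r by blast
    moreover obtain E2 where "E2 \<in> approach_sets T2 t2" "r2 \<in> E2" using p S2 r by blast
    moreover obtain E3 where "E3 \<in> approach_sets {a..b} t3" "r3 \<in> E3" using p S3 r by blast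
    ultimately show ?thesis unfolding A_def r by (intro bexI[of _ "E1 \<times> E2 \<times> E3"]) auto
  qed
  then have "\<forall>p\<in>(U \<inter> (S1 \<times> S2 \<times> S3)) \<inter> (T1 \<times> T2 \<times> {a..b}). \<bar>h p\<bar> \<le> M"
    using U(3) by (meson IntD1 IntD2)
  moreover have "open (U \<inter> (S1 \<times> S2 \<times> S3))" "P \<in> U \<inter> (S1 \<times> S2 \<times> S3)"
    using U S1 S2 S3 P_eq by (auto intro!: open_Int open_Times)
  ultimately show ?thesis by blast
qed

lemma rd_continuous3_bounded:
  assumes "rd_continuous3 T1 T2 {a..b} h"
  shows "\<exists>B. \<forall>s\<in>T1. s \<le> M \<longrightarrow> (\<forall>t\<in>T2. t \<le> N \<longrightarrow> (\<forall>q\<in>{a..b}. \<bar>h (s, t, q)\<bar> \<le> B))"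
proof -
  define K where "K = (T1 \<inter> {x0..M}) \<times> (T2 \<inter> {y0..N}) \<times> {a..b}"
  have "compact K"
    unfolding K_def using X.closed_T Y.closed_T by (intro compact_Times closed_Int_compact) auto
  then have "\<exists>B. \<forall>p\<in>K. \<bar>h p\<bar> \<le> B"
  proof (rule compact_locally_bounded)
    fix P assume "P \<in> K"
    then have "P \<in> T1 \<times> T2 \<times> {a..b}" by (auto simp: K_def)
    from rd_continuous3_locally_bounded[OF assms this]
    obtain U B where "open U" "P \<in> U" "\<forall>p\<in>U \<inter> (T1 \<times> T2 \<times> {a..b}). \<bar>h p\<bar> \<le> B" by blast
    then show "\<exists>U B. open U \<and> P \<in> U \<and> (\<forall>p\<in>U \<inter> K. \<bar>h p\<bar> \<le> B)"
      by (intro exI[of _ U] exI[of _ B]) (auto simp: K_def)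
  qed
  then obtain B where "\<And>p. p \<in> K \<Longrightarrow> \<bar>h p\<bar> \<le> B" by blast
  then show ?thesis using X.x0_le Y.x0_le by (intro exI[of _ B]) (auto simp: K_def)
qed

section \<open>Iterated integrals of a jointly rd-continuous function\<close>

context
  fixes h :: "real \<times> real \<times> real \<Rightarrow> real"
  assumes h: "rd_continuous3 T1 T2 {a..b} h"
begin

lemma inner_integrable:
  "s \<in> T1 \<Longrightarrow> t \<in> T2 \<Longrightarrow> (\<lambda>q. h (s, t, q)) integrable_on {a..b}"
  using rd_continuous3_section3[OF h, of s t a] ab
  by (intro integrable_continuous_real rd_continuous1_interval) auto

lemma inner_bounded:
  "\<exists>B. \<forall>s\<in>T1. s \<le> M \<longrightarrow> (\<forall>t\<in>T2. t \<le> N \<longrightarrow> \<bar>integral {a..b} (\<lambda>q. h (s, t, q))\<bar> \<le> B)"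
proof -
  obtain B where B: "\<And>s t q. s \<in> T1 \<Longrightarrow> s \<le> M \<Longrightarrow> t \<in> T2 \<Longrightarrow> t \<le> N \<Longrightarrow> q \<in> {a..b} \<Longrightarrow> \<bar>h (s, t, q)\<bar> \<le> B"
    using rd_continuous3_bounded[OF h, of M N] by blast
  have "\<bar>integral {a..b} (\<lambda>q. h (s, t, q))\<bar> \<le> B * (b - a)"
    if st: "s \<in> T1" "s \<le> M" "t \<in> T2" "t \<le> N" for s t
  proof -
    have "0 \<le> B" using B[OF st, of a] ab by force
    then show ?thesis
      using integral_near_const[OF inner_integrable[OF st(1,3)], of "{}" B 0] B[OF st] ab by auto
  qed
  then show ?thesis by blast
qed

lemma inner_rd1:
  assumes t: "t \<in> T2"
  shows "rd_continuous1 T1 (\<lambda>s. integral {a..b} (\<lambda>q. h (s, t, q)))"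
proof (rule rd_continuous1_integral)
  show "\<exists>B. \<forall>s\<in>T1. s \<le> M \<longrightarrow> (\<forall>q\<in>{a..b}. \<bar>h (s, t, q)\<bar> \<le> B)" for M
    using rd_continuous3_bounded[OF h, of M t] t by blast
qed (use inner_integrable t rd_continuous3_section1[OF h X.x0_in] in auto)

lemma inner_rd2:
  assumes s: "s \<in> T1"
  shows "rd_continuous1 T2 (\<lambda>t. integral {a..b} (\<lambda>q. h (s, t, q)))"
proof (rule rd_continuous1_integral)
  show "\<exists>B. \<forall>t\<in>T2. t \<le> N \<longrightarrow> (\<forall>q\<in>{a..b}. \<bar>h (s, t, q)\<bar> \<le> B)" for N
    using rd_continuous3_bounded[OF h, of s N] s by blast
qed (use inner_integrable s rd_continuous3_section2[OF h _ Y.x0_in] in auto)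

text \<open>Written as an ordinary integral over {y0..y} along the floor map, the delta integral
  falls under \<open>rd_continuous1_integral\<close>. This makes the inner double integral an
  admissible integrand for the outer delta integral.\<close>

lemma delta_integral_rd1:
  assumes y: "y \<in> T2"
  shows "rd_continuous1 T1 (\<lambda>s. delta_integral T2 y0 y (\<lambda>t. integral {a..b} (\<lambda>q. h (s, t, q))))"
proof (rule rd_continuous1_cong)
  let ?G = "\<lambda>s r. integral {a..b} (\<lambda>q. h (s, floor_in T2 r, q))"
  show "rd_continuous1 T1 (\<lambda>s. integral {y0..y} (?G s))"
  proof (rule rd_continuous1_integral)
    show "?G s integrable_on {y0..y}" if "s \<in> T1" for s
      by (rule Y.rd_integrable[OF inner_rd2[OF that]])
    show "rd_continuous1 T1 (\<lambda>s. ?G s r)" if "r \<in> {y0..y}" for r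
      using that by (intro inner_rd1 Y.floor_in_in) auto
    show "\<exists>B. \<forall>s\<in>T1. s \<le> M \<longrightarrow> (\<forall>r\<in>{y0..y}. \<bar>?G s r\<bar> \<le> B)" for M
    proof -
      obtain B where "\<And>s t. s \<in> T1 \<Longrightarrow> s \<le> M \<Longrightarrow> t \<in> T2 \<Longrightarrow> t \<le> y \<Longrightarrow> \<bar>integral {a..b} (\<lambda>q. h (s, t, q))\<bar> \<le> B"
        using inner_bounded[of M y] by blast
      then show ?thesis using Y.floor_in_in Y.floor_in_le by (intro exI[of _ B]) force
    qed
  qed
  show "integral {y0..y} (?G s) = delta_integral T2 y0 y (\<lambda>t. integral {a..b} (\<lambda>q. h (s, t, q)))"
    if "s \<in> T1" for s
    using Y.delta_integral_eq[OF inner_rd2[OF that] y] by simp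
qed

end

end

section \<open>Gronwall inequalities\<close>

context based_time_scale
begin

lemma delta_integral_le:
  assumes rd: "rd_continuous1 T g" "rd_continuous1 T g1" "rd_continuous1 T g2" and x: "x \<in> T"
    and le: "\<And>t. t \<in> T \<Longrightarrow> t \<le> x \<Longrightarrow> g t \<le> g1 t + k * g2 t"
  shows "delta_integral T x0 x g \<le> delta_integral T x0 x g1 + k * delta_integral T x0 x g2"
proof -
  have int: "(\<lambda>s. g (floor_in T s)) integrable_on {x0..x}"
      "(\<lambda>s. g1 (floor_in T s)) integrable_on {x0..x}"
      "(\<lambda>s. k * g2 (floor_in T s)) integrable_on {x0..x}"
    using rd by (auto intro!: rd_integrable integrable_on_mult_right)
  have "integral {x0..x} (\<lambda>s. g (floor_in T s))
      \<le> integral {x0..x} (\<lambda>s. g1 (floor_in T s) + k * g2 (floor_in T s))"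
  proof (intro integral_le integrable_add int)
    fix s assume "s \<in> {x0..x}"
    then show "g (floor_in T s) \<le> g1 (floor_in T s) + k * g2 (floor_in T s)"
      using floor_in_in floor_in_le by (intro le) force+
  qed
  then show ?thesis
    using rd x by (simp add: delta_integral_eq integral_add[OF int(2,3)])
qed

lemma delta_integral_mono:
  assumes "rd_continuous1 T g" "rd_continuous1 T g1" "x \<in> T" "\<And>t. t \<in> T \<Longrightarrow> t \<le> x \<Longrightarrow> g t \<le> g1 t"
  shows "delta_integral T x0 x g \<le> delta_integral T x0 x g1"
  using delta_integral_le[OF assms(1,2,2,3), of 0] assms(4) by simp

lemma delta_integral_upper_mono:
  assumes rd: "rd_continuous1 T g" and x: "x \<in> T" "x' \<in> T" "x \<le> x'"
    and nonneg: "\<And>t. t \<in> T \<Longrightarrow> 0 \<le> g t"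
  shows "delta_integral T x0 x g \<le> delta_integral T x0 x' g"
proof -
  have "integral {x0..x} (\<lambda>s. g (floor_in T s)) \<le> integral {x0..x'} (\<lambda>s. g (floor_in T s))"
    using x nonneg floor_in_in by (intro integral_subset_le rd_integrable[OF rd]) auto
  then show ?thesis using rd x by (simp add: delta_integral_eq)
qed

lemma delta_integral_nonneg:
  assumes rd: "rd_continuous1 T g" and x: "x \<in> T" and nonneg: "\<And>t. t \<in> T \<Longrightarrow> 0 \<le> g t"
  shows "0 \<le> delta_integral T x0 x g"
  unfolding delta_integral_eq[OF rd x]
  using nonneg floor_in_in by (intro integral_nonneg rd_integrable[OF rd]) auto

text \<open>With W and C the integrals of g and c, and e the exponential, compare D t = C x * (e t -
  1) - W t + C t with 0. It vanishes at x0 and equals C x * e x - W x at x. Its delta derivative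
  minus q t * D t is (c t + W t * q t - g t) + q t * (C x - C t), where both summands are
  nonnegative for t < x, the second because C increases.\<close>

lemma delta_gronwall:
  assumes rd: "rd_continuous1 T g" "rd_continuous1 T c" "rd_continuous1 T q"
    and c0: "\<And>t. t \<in> T \<Longrightarrow> 0 \<le> c t" and q0: "\<And>t. t \<in> T \<Longrightarrow> 0 \<le> q t" and x: "x \<in> T"
    and le: "\<And>t. t \<in> T \<Longrightarrow> t \<le> x \<Longrightarrow> g t \<le> c t + delta_integral T x0 t g * q t"
  shows "delta_integral T x0 x g \<le> delta_integral T x0 x c * delta_exp T q x x0"
proof -
  obtain e where e: "\<And>t. t \<in> T \<Longrightarrow> has_delta_derivative T e (q t * e t) t" "e x0 = 1"
    "\<And>t. t \<in> T \<Longrightarrow> delta_exp T q t x0 = e t"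
    using delta_exp_solution[OF rd(3) q0] by blast
  define W where "W = (\<lambda>x. integral {x0..x} (\<lambda>s. g (floor_in T s)))"
  define C where "C = (\<lambda>x. integral {x0..x} (\<lambda>s. c (floor_in T s)))"
  have W: "delta_integral T x0 t g = W t" and C: "delta_integral T x0 t c = C t" if "t \<in> T" for t
    using rd that by (simp_all add: delta_integral_eq W_def C_def)
  obtain K where K: "\<And>t. t \<in> T \<Longrightarrow> t \<le> x \<Longrightarrow> \<bar>q t\<bar> \<le> K" using rd_bounded[OF rd(3)] by blast
  \<comment> \<open>Replacing C t by the constant C x in front of e avoids a product rule for delta derivatives.\<close>
  let ?D = "\<lambda>t. 0 + 1 * (- C x + C x * e t + (- 1) * W t) + 1 * C t"
  have "0 \<le> ?D x"
  proof (rule delta_comparison[where D = ?D and q = q and K = K])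
    show "has_delta_derivative T ?D (1 * (C x * (q t * e t) + (- 1) * g t) + 1 * c t) t"
      if "t \<in> kappa T" for t
      using e(1) rd kappa_subset[OF that] unfolding W_def C_def
      by (intro delta_derivative_lincomb delta_derivative_integral)
    show "q t * ?D t \<le> 1 * (C x * (q t * e t) + (- 1) * g t) + 1 * c t" if t: "t \<in> T" "t < x" for t
    proof -
      have "C t \<le> C x"
        using delta_integral_upper_mono[OF rd(2) t(1) x _ c0] t C x by simp
      then have "q t * C t \<le> q t * C x" using q0[OF t(1)] by (rule mult_left_mono)
      moreover have "g t \<le> c t + W t * q t" using le[OF t(1)] t W by simp
      ultimately show ?thesis by (simp add: algebra_simps)
    qed
    show "0 \<le> q t \<and> q t \<le> K" if "t \<in> T" "t < x" for t
      using q0[OF that(1)] K[of t] that by simp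
    show "0 \<le> ?D x0" using e(2) by (simp add: W_def C_def)
  qed (rule x)
  then show ?thesis using W C e(3) x by simp
qed

end

section \<open>Reduction of the triple integral inequality to one variable\<close>

context two_time_scales
begin

text \<open>For fixed y this is \<open>delta_gronwall\<close> with g, c, q given by J of u, p1, p2.
  The hypothesis at (s, t, q) involves w s t, which depends on the integration variable t; it is
  raised to w s y so that it can leave the integral.\<close>

lemma integral_gronwall:
  fixes u p1 p2 f :: "real \<times> real \<times> real \<Rightarrow> real"
  defines "J \<equiv> \<lambda>p s y. delta_integral T2 y0 y (\<lambda>t. integral {a..b} (\<lambda>q. f (s, t, q) * p (s, t, q)))"
  assumes rd: "u \<in> Crd3 T1 T2 {a..b} {0..}" "p1 \<in> Crd3 T1 T2 {a..b} {0..}"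
      "p2 \<in> Crd3 T1 T2 {a..b} {0..}" "f \<in> Crd3 T1 T2 {a..b} {0..}"
    and ineq: "\<And>x y z. x \<in> T1 \<Longrightarrow> y \<in> T2 \<Longrightarrow> z \<in> {a..b} \<Longrightarrow>
      u (x, y, z) \<le> p1 (x, y, z) + p2 (x, y, z) * delta_integral T1 x0 x (\<lambda>s. J u s y)"
    and x: "x \<in> T1" and y: "y \<in> T2"
  shows "delta_integral T1 x0 x (\<lambda>s. J u s y)
    \<le> delta_integral T1 x0 x (\<lambda>s. J p1 s y) * delta_exp T1 (\<lambda>s. J p2 s y) x x0"
proof -
  have rd3: "rd_continuous3 T1 T2 {a..b} (\<lambda>P. f P * p P)" if "p \<in> Crd3 T1 T2 {a..b} {0..}" for p
    using that rd(4) unfolding Crd3_def by (auto intro: rd_continuous3_mult)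
  have nonneg: "0 \<le> p (s, t, q)"
    if "p \<in> Crd3 T1 T2 {a..b} {0..}" "s \<in> T1" "t \<in> T2" "q \<in> {a..b}" for p s t q
    using that unfolding Crd3_def by fastforce
  have inner_nonneg: "0 \<le> integral {a..b} (\<lambda>q. f (s, t, q) * p (s, t, q))"
    if "p \<in> Crd3 T1 T2 {a..b} {0..}" "s \<in> T1" "t \<in> T2" for p s t
    using inner_integrable[OF rd3] nonneg[OF rd(4)] nonneg that by (intro integral_nonneg) auto
  have J_rd: "rd_continuous1 T1 (\<lambda>s. J p s t)" if "p \<in> Crd3 T1 T2 {a..b} {0..}" "t \<in> T2" for p t
    unfolding J_def by (rule delta_integral_rd1[OF rd3]) (rule that)+
  have J_mono: "J p s t \<le> J p s t'"
    if "p \<in> Crd3 T1 T2 {a..b} {0..}" "s \<in> T1" "t \<in> T2" "t' \<in> T2" "t \<le> t'" for p s t t'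
    unfolding J_def using that inner_nonneg
    by (intro Y.delta_integral_upper_mono inner_rd2[OF rd3]) auto
  have J_nonneg: "0 \<le> J p s t" if "p \<in> Crd3 T1 T2 {a..b} {0..}" "s \<in> T1" "t \<in> T2" for p s t
    unfolding J_def using that inner_nonneg
    by (intro Y.delta_integral_nonneg inner_rd2[OF rd3]) auto
  define w where "w = (\<lambda>s t. delta_integral T1 x0 s (\<lambda>s. J u s t))"
  have "J u s y \<le> J p1 s y + w s y * J p2 s y" if s: "s \<in> T1" for s
    unfolding J_def
  proof (rule Y.delta_integral_le)
    fix t assume t: "t \<in> T2" "t \<le> y"
    have "w s t \<le> w s y"
      unfolding w_def using rd s t y J_mono by (intro X.delta_integral_mono J_rd) auto
    have le: "f (s, t, q) * u (s, t, q) \<le> f (s, t, q) * p1 (s, t, q) + w s y * (f (s, t, q) * p2 (s, t, q))"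
      if q: "q \<in> {a..b}" for q
    proof -
      \<comment> \<open>The hypothesis is used with the integration variable q in place of
        z.\<close>
      have "u (s, t, q) \<le> p1 (s, t, q) + p2 (s, t, q) * w s t"
        using ineq[OF s t(1) q] by (simp add: w_def)
      also have "\<dots> \<le> p1 (s, t, q) + p2 (s, t, q) * w s y"
        using \<open>w s t \<le> w s y\<close> nonneg[OF rd(3) s t(1) q] by (intro add_left_mono mult_left_mono)
      finally have "f (s, t, q) * u (s, t, q) \<le> f (s, t, q) * (p1 (s, t, q) + p2 (s, t, q) * w s y)"
        using nonneg[OF rd(4) s t(1) q] by (rule mult_left_mono)
      then show ?thesis by (simp add: algebra_simps)
    qed
    note int = inner_integrable[OF rd3 s t(1)]
    have "integral {a..b} (\<lambda>q. f (s, t, q) * u (s, t, q))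
        \<le> integral {a..b} (\<lambda>q. f (s, t, q) * p1 (s, t, q) + w s y * (f (s, t, q) * p2 (s, t, q)))"
      using le by (intro integral_le int[OF rd(1)] integrable_add integrable_on_mult_right int[OF rd(2)] int[OF rd(3)])
    then show "integral {a..b} (\<lambda>q. f (s, t, q) * u (s, t, q))
        \<le> integral {a..b} (\<lambda>q. f (s, t, q) * p1 (s, t, q)) + w s y * integral {a..b} (\<lambda>q. f (s, t, q) * p2 (s, t, q))"
      using integral_add[OF int[OF rd(2)] integrable_on_mult_right[OF int[OF rd(3)]]] by simp
  qed (use inner_rd2[OF rd3 s] rd y in auto)
  then show ?thesis
    using rd x y J_nonneg by (intro X.delta_gronwall J_rd) (auto simp: w_def)
qed

end

theorem theorem2p1:
  fixes T1 T2 :: "real set" and x0 y0 a b :: real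
    and u p1 p2 f :: "real \<times> real \<times> real \<Rightarrow> real"
    and Q :: "real \<Rightarrow> real \<Rightarrow> real \<Rightarrow> real" and C :: "real \<Rightarrow> real \<Rightarrow> real"
  assumes T1: "time_scale T1" "\<exists>s\<in>T1. \<exists>t\<in>T1. s \<noteq> t"
    and T2: "time_scale T2" "\<exists>s\<in>T2. \<exists>t\<in>T2. s \<noteq> t"
    and x0: "x0 \<in> T1" "\<forall>x\<in>T1. x0 \<le> x"
    and y0: "y0 \<in> T2" "\<forall>y\<in>T2. y0 \<le> y"
    and ab: "a < b"
    and rd: "u \<in> Crd3 T1 T2 {a..b} {0..}" "p1 \<in> Crd3 T1 T2 {a..b} {0..}"
      "p2 \<in> Crd3 T1 T2 {a..b} {0..}" "f \<in> Crd3 T1 T2 {a..b} {0..}"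
    and ineq: "\<forall>x\<in>T1. \<forall>y\<in>T2. \<forall>z\<in>{a..b}.
      u (x, y, z) \<le> p1 (x, y, z) + p2 (x, y, z) *
        delta_integral T1 x0 x (\<lambda>s. delta_integral T2 y0 y (\<lambda>\<tau>.
          integral {a..b} (\<lambda>q. f (s, \<tau>, q) * u (s, \<tau>, q))))"
    and Q: "\<And>x y z. Q x y z =
      delta_integral T2 y0 y (\<lambda>\<tau>. integral {a..b} (\<lambda>q. f (x, \<tau>, q) * p2 (x, \<tau>, q)))"
    and C: "\<And>x y. C x y =
      delta_integral T1 x0 x (\<lambda>s. delta_integral T2 y0 y (\<lambda>\<tau>.
        integral {a..b} (\<lambda>q. f (s, \<tau>, q) * p1 (s, \<tau>, q))))"
  shows "\<forall>x\<in>T1. \<forall>y\<in>T2. \<forall>z\<in>{a..b}.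
    u (x, y, z) \<le> p1 (x, y, z) + p2 (x, y, z) * C x y * delta_exp T1 (\<lambda>s. Q s y z) x x0"
proof (intro ballI)
  interpret two_time_scales T1 x0 T2 y0 a b
    using T1 T2 x0 y0 ab by unfold_locales (auto simp: time_scale_def)
  fix x y z assume xyz: "x \<in> T1" "y \<in> T2" "z \<in> {a..b}"
  let ?w = "delta_integral T1 x0 x (\<lambda>s. delta_integral T2 y0 y (\<lambda>\<tau>.
          integral {a..b} (\<lambda>q. f (s, \<tau>, q) * u (s, \<tau>, q))))"
  have "?w \<le> C x y * delta_exp T1 (\<lambda>s. Q s y z) x x0"
    unfolding C Q using ineq by (intro integral_gronwall[OF rd _ xyz(1,2)]) blast
  moreover have "0 \<le> p2 (x, y, z)" using rd(3) xyz unfolding Crd3_def by fastforce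
  ultimately have "p2 (x, y, z) * ?w \<le> p2 (x, y, z) * C x y * delta_exp T1 (\<lambda>s. Q s y z) x x0"
    unfolding mult.assoc by (rule mult_left_mono)
  with ineq xyz show "u (x, y, z) \<le> p1 (x, y, z) + p2 (x, y, z) * C x y * delta_exp T1 (\<lambda>s. Q s y z) x x0"
    by fastforce
qed

end
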